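(* Suppose that $f$ is a PWL (orientation preserving) homeomorphism of the circle with $n$ break points $b_1,\dots,b_n$, $n\ge 2$, and rational rotation number $\rho=p/q$. The following five statements are equivalent. (i) The union of the forwards and backwards orbit of every break point contains at least one other break point, and if $S$ is the set of indices of the break points lying on the same orbit (union of forwards and backwards orbit), then $f$ has trivial cancellations on $S$. (ii) $f$ has an absolutely continuous invariant probability measure with support equal to $\mathbb{S}^1$. (iii) $f$ is conjugate to a rigid rotation by a PWL conjugating function. (iv) There is a constant $N_1$, independent of $k$, such that the number of break points of $f^k$ is bounded by $N_1$ for all $k\ge 1$. (v) There is a constant $N_2$, independent of $k$ (and of $x$), such that the one-sided derivatives $(f^k)'(x_\pm)$ are bounded by $N_2$ for all $k\ge 1$ and all $x$.
   Context: The circle $\mathbb{S}^1=\mathbb{R}/\mathbb{Z}$ is parametrized by $x\in[0,1)$. An orientation preserving homeomorphism $f$ of the circle is described by a lift $F:\mathbb{R}\to\mathbb{R}$, continuous and strictly increasing with $F(x+1)=F(x)+1$ and $f(x)=F(x)\ (\mathrm{mod}\ 1)$; two lifts of $f$ differ by an integer. $f$ is piecewise linear (PWL) if there is a finite set of break points $0\le b_1<b_2<\dots<b_n<1$ such that $F$ is affine on each interval $(b_i,b_{i+1})$, $1\le i\le n-1$, and on $(b_n,b_1+1)$, and at each break point $F'(b_{i,-})=\lim_{x\uparrow b_i}F'(x)\neq\lim_{x\downarrow b_i}F'(x)=F'(b_{i,+})$. Break points of an iterate $f^k$ are the points at which the left and right derivatives of $f^k$ differ. The rotation number of a lift is $\rho(F)=\lim_{m\to\infty}\frac1m(F^m(x)-x)$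 (it exists and is independent of $x$), and $\rho(f)=\rho(F)\ (\mathrm{mod}\ 1)$. A rigid rotation is a map $r_\omega(x)=x+\omega\ (\mathrm{mod}\ 1)$. Maps $f,g$ of the circle are conjugate if there is a homeomorphism $h$ of the circle (the conjugating function) with $h\circ f=g\circ h$. The jump at a break point is $J(b_i)=F'(b_{i,+})/F'(b_{i,-})$. For a set $S\subset\{1,\dots,n\}$ of $p$ distinct indices, $1<p\le n$, $f$ has trivial cancellations on $S$ if $\prod_{i\in S}J(b_i)=1$. A measure $\nu$ on the circle is invariant for $f$ if $\nu(f^{-1}(A))=\nu(A)$ for all measurable $A$; it is absolutely continuous if $\ell(A)=0$ implies $\nu(A)=0$, where $\ell$ is Lebesgue (Haar) measure on the circle. $(f^k)'(x_\pm)$ denotes the right ($+$) and left ($-$) derivatives of $f^k$ at $x$. *)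

theory Defs
  imports "HOL-Analysis.Analysis" "HOL-Probability.Probability_Measure"
begin

section \<open>The circle as the quotient of the real line by the integers\<close>

quotient_type circle = real / "\<lambda>x y :: real. x - y \<in> \<int>"
  morphisms rep_circle to_circle
proof (rule equivpI)
  show "reflp (\<lambda>x y :: real. x - y \<in> \<int>)"
    by (simp add: reflp_def)
  show "symp (\<lambda>x y :: real. x - y \<in> \<int>)"
    unfolding symp_def by (metis Ints_minus minus_diff_eq)
  show "transp (\<lambda>x y :: real. x - y \<in> \<int>)"
    unfolding transp_def by (metis Ints_add diff_add_cancel add_diff_eq)
qed

text \<open>The quotient topology.\<close>

instantiation circle :: topological_space
begin

definition open_circle :: "circle set \<Rightarrow> bool"
  where "open_circle U \<longleftrightarrow> open (to_circle -` U)"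

instance
  by standard (auto simp: open_circle_def vimage_Union)

end

lemma continuous_on_to_circle: "continuous_on A to_circle"
  by (rule continuous_on_subset[of UNIV])
     (auto simp: continuous_on_open_vimage open_circle_def)

lemma measurable_to_circle [measurable]: "to_circle \<in> borel_measurable borel"
  by (rule borel_measurable_continuous_onI[OF continuous_on_to_circle])

text \<open>Lebesgue (Haar) measure on the circle, normalised to total mass 1.\<close>

definition circle_lebesgue :: "circle measure"
  where "circle_lebesgue = distr (restrict_space lborel {0..<1}) borel to_circle"

lift_definition rotation :: "real \<Rightarrow> circle \<Rightarrow> circle"
  is "\<lambda>\<omega> x. x + \<omega>"
  by simp


section \<open>Orientation preserving homeomorphisms and their lifts\<close>

definition is_lift :: "(circle \<Rightarrow> circle) \<Rightarrow> (real \<Rightarrow> real) \<Rightarrow> bool"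
  where "is_lift f F \<longleftrightarrow> continuous_on UNIV F \<and> strict_mono F \<and>
    (\<forall>x. F (x + 1) = F x + 1) \<and> (\<forall>x. f (to_circle x) = to_circle (F x))"

definition orientation_preserving_homeo :: "(circle \<Rightarrow> circle) \<Rightarrow> bool"
  where "orientation_preserving_homeo f \<longleftrightarrow>
    (\<exists>g. homeomorphism UNIV UNIV f g) \<and> (\<exists>F. is_lift f F)"

definition lift_rotation_number :: "(real \<Rightarrow> real) \<Rightarrow> real"
  where "lift_rotation_number F = (THE \<rho>. \<forall>x. (\<lambda>m. ((F ^^ m) x - x) / real m) \<longlonglongrightarrow> \<rho>)"

text \<open>Lifts differ by integers, so that all of them give the same point of the circle.\<close>

definition rotation_number :: "(circle \<Rightarrow> circle) \<Rightarrow> circle"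
  where "rotation_number f = (THE r. \<exists>F. is_lift f F \<and> r = to_circle (lift_rotation_number F))"

text \<open>The one-sided derivatives of a circle map are those of a lift. They depend neither on the
  lift nor on the chosen representative of the point.\<close>

definition deriv_right :: "(circle \<Rightarrow> circle) \<Rightarrow> circle \<Rightarrow> real"
  where "deriv_right f x = (THE D. \<exists>F t. is_lift f F \<and> to_circle t = x \<and>
    (F has_real_derivative D) (at_right t))"

definition deriv_left :: "(circle \<Rightarrow> circle) \<Rightarrow> circle \<Rightarrow> real"
  where "deriv_left f x = (THE D. \<exists>F t. is_lift f F \<and> to_circle t = x \<and>
    (F has_real_derivative D) (at_left t))"

definition break_points :: "(circle \<Rightarrow> circle) \<Rightarrow> circle set"
  where "break_points f = {x. deriv_left f x \<noteq> deriv_right f x}"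

definition jump :: "(circle \<Rightarrow> circle) \<Rightarrow> circle \<Rightarrow> real"
  where "jump f x = deriv_right f x / deriv_left f x"

definition is_affine_on :: "real set \<Rightarrow> (real \<Rightarrow> real) \<Rightarrow> bool"
  where "is_affine_on I F \<longleftrightarrow> (\<exists>a c. \<forall>x\<in>I. F x = a * x + c)"

text \<open>\<open>pwl_with_breaks f n b\<close>: the map is piecewise linear with exactly the break points
  \<open>b 1 < \<dots> < b n\<close> in \<open>[0, 1)\<close>. The case \<open>n = 0\<close> (rigid rotations) is included.\<close>

definition pwl_with_breaks :: "(circle \<Rightarrow> circle) \<Rightarrow> nat \<Rightarrow> (nat \<Rightarrow> real) \<Rightarrow> bool"
  where "pwl_with_breaks f n b \<longleftrightarrow>
    orientation_preserving_homeo f \<and>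
    (\<forall>i\<in>{1..n}. 0 \<le> b i \<and> b i < 1) \<and> strict_mono_on {1..n} b \<and>
    (\<exists>F. is_lift f F \<and>
      (\<forall>i\<in>{1..<n}. is_affine_on {b i<..<b (i + 1)} F) \<and>
      (if n = 0 then is_affine_on UNIV F else is_affine_on {b n<..<b 1 + 1} F)) \<and>
    (\<forall>i\<in>{1..n}. to_circle (b i) \<in> break_points f)"

definition pwl :: "(circle \<Rightarrow> circle) \<Rightarrow> bool"
  where "pwl f \<longleftrightarrow> (\<exists>n b. pwl_with_breaks f n b)"


section \<open>Orbits, cancellations, and invariant measures\<close>

definition full_orbit :: "(circle \<Rightarrow> circle) \<Rightarrow> circle \<Rightarrow> circle set"
  where "full_orbit f x = range (\<lambda>k. (f ^^ k) x) \<union> range (\<lambda>k. (inv f ^^ k) x)"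

definition trivial_cancellations ::
    "(circle \<Rightarrow> circle) \<Rightarrow> nat \<Rightarrow> (nat \<Rightarrow> real) \<Rightarrow> nat set \<Rightarrow> bool"
  where "trivial_cancellations f n b S \<longleftrightarrow>
    S \<subseteq> {1..n} \<and> 1 < card S \<and> card S \<le> n \<and> (\<Prod>i\<in>S. jump f (to_circle (b i))) = 1"

definition invariant_measure :: "(circle \<Rightarrow> circle) \<Rightarrow> circle measure \<Rightarrow> bool"
  where "invariant_measure f \<nu> \<longleftrightarrow> sets \<nu> = sets borel \<and>
    (\<forall>A\<in>sets \<nu>. emeasure \<nu> (f -` A) = emeasure \<nu> A)"

definition measure_support :: "circle measure \<Rightarrow> circle set"
  where "measure_support \<nu> = {x. \<forall>U. open U \<and> x \<in> U \<longrightarrow> emeasure \<nu> U > 0}"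


definition all_equivalent :: "bool list \<Rightarrow> bool"
  where "all_equivalent Ps \<longleftrightarrow> (\<forall>P\<in>set Ps. \<forall>Q\<in>set Ps. P \<longleftrightarrow> Q)"

end

theory Submission
  imports Defs
begin

text \<open>All five conditions are equivalent to \<open>f\<close> being periodic, \<open>f ^^ Q = id\<close> with \<open>Q = q\<close>; the proof
compares each of them with this one.

Because the rotation number is \<open>p / q\<close>, some lift \<open>F\<close> makes \<open>G x = (F ^^ Q) x - p\<close> a lift of
\<open>f ^^ Q\<close> with a fixed point (\<open>periodic_point_of_rational_rotation_number\<close>). If \<open>f ^^ Q\<close> is not the
identity, there is a gap: an interval \<open>(a, b)\<close> between consecutive fixed points of \<open>G\<close>, on which
\<open>G\<close> moves all points in the same direction (\<open>exists_gap\<close>). Since \<open>G\<close> is affine near either end, its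
inner slopes at \<open>a\<close> and \<open>b\<close> lie strictly on opposite sides of \<open>1\<close> (\<open>slopes_at_gap_ends\<close>). A gap
contradicts every one of the five conditions:

\<^item> The derivative of \<open>G\<close> at the repelling end is larger than \<open>1\<close>, so the derivatives of the iterates
  are unbounded.
\<^item> The ratio of the two end slopes is the product of all jumps of \<open>f\<close> met by the first \<open>Q\<close> images of
  the gap. How often a point is met depends only on its orbit, so the ratio is a product of powers of
  the jump products of whole orbits; as it is not \<open>1\<close>, some orbit through the gap has a jump product
  other than \<open>1\<close> (\<open>nontrivial_orbit_product\<close>). This refutes the cancellation condition. Moreover, this
  orbit is infinite, and \<open>f ^^ k\<close> has a break point at each of its points whose first \<open>k\<close> iterates
  contain all break points of the orbit, so the number of break points of \<open>f ^^ k\<close> grows without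
  bound (\<open>unbounded_break_points\<close>).
\<^item> The interval between a point of the gap and its image is wandering, and an invariant probability
  measure vanishes on wandering sets (\<open>wandering_set_null\<close>).
\<^item> A rotation that is conjugate to \<open>f\<close> has a point of period \<open>Q\<close>, so its \<open>Q\<close>-th iterate is the
  identity, and hence so is that of \<open>f\<close>.

Conversely let \<open>f ^^ Q = id\<close>. There are only finitely many different iterates, which bounds break points
and derivatives. The jumps of \<open>f ^^ Q = id\<close> are trivial, and multiplied along an orbit they give a
power of the jump product of the orbit (\<open>orbit_product_trivial_if_periodic\<close>). The average of the
lifts of \<open>f ^^ i\<close> over \<open>i < Q\<close> conjugates \<open>f\<close> to a rotation, and the average of the images of
Lebesgue measure under these iterates is an invariant measure.

Piecewise linearity is used in a local form: the lift is affine on a one-sided neighbourhood on either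
side of every point (\<open>pl_lift\<close>). This form passes at once to iterates and averages; the
enumeration of the break points is translated into it in \<open>pwl_with_breaksD\<close> and recovered in
\<open>pwl_of_pl_lift\<close>.\<close>

section \<open>The circle and lifts of its homeomorphisms\<close>

lemma to_circle_eq_iff: "to_circle x = to_circle y \<longleftrightarrow> x - y \<in> \<int>"
  by (rule circle.abs_eq_iff)

lemma to_circle_add_of_int [simp]: "to_circle (x + of_int k) = to_circle x"
  by (simp add: to_circle_eq_iff)

lemma to_circle_representative:
  obtains t where "u \<le> t" "t < u + 1" "to_circle t = x"
proof -
  obtain s where s: "to_circle s = x"
    using Quotient3_abs_rep[OF Quotient3_circle] by blast
  show thesis
  proof
    show "u \<le> s + of_int (- \<lfloor>s - u\<rfloor>)" "s + of_int (- \<lfloor>s - u\<rfloor>) < u + 1"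
      by linarith+
    show "to_circle (s + of_int (- \<lfloor>s - u\<rfloor>)) = x"
      by (simp only: to_circle_add_of_int s)
  qed
qed

lemma Ints_abs_less_1: "z \<in> \<int> \<Longrightarrow> \<bar>z :: real\<bar> < 1 \<Longrightarrow> z = 0"
  by (auto elim!: Ints_cases)

lemma inj_on_to_circle:
  assumes "b \<le> a + 1"
  shows "inj_on to_circle {a<..<b}"
proof (rule inj_onI)
  fix x y assume "x \<in> {a<..<b}" "y \<in> {a<..<b}" "to_circle x = to_circle y"
  then have "x - y \<in> \<int>" "\<bar>x - y\<bar> < 1"
    using assms by (auto simp: to_circle_eq_iff)
  then show "x = y"
    using Ints_abs_less_1 by fastforce
qed

lemma to_circle_eqE:
  assumes "to_circle x = to_circle y"
  obtains k where "x = y + of_int k"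
  using assms unfolding to_circle_eq_iff by (metis Ints_cases add.commute diff_add_cancel)

lemma open_to_circle_image:
  assumes "open A"
  shows "open (to_circle ` A)"
proof -
  have "to_circle -` to_circle ` A = (\<Union>k. (\<lambda>x. x + of_int k) ` A)"
  proof (rule set_eqI, rule iffI)
    fix x assume "x \<in> to_circle -` to_circle ` A"
    then obtain y where "y \<in> A" "to_circle x = to_circle y"
      by auto
    then show "x \<in> (\<Union>k. (\<lambda>x. x + of_int k) ` A)"
      by (metis UNIV_I UN_I imageI to_circle_eqE)
  qed auto
  moreover have "open ((\<lambda>x. x + of_int k) ` A)" for k :: int
    using open_translation[OF assms, of "of_int k"] by (simp add: add.commute)
  ultimately show ?thesis
    unfolding open_circle_def by (metis open_UN)
qed

lemma is_liftD:
  assumes "is_lift f F"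
  shows "continuous_on UNIV F" "strict_mono F" "F (x + 1) = F x + 1" "f (to_circle x) = to_circle (F x)"
  using assms by (auto simp: is_lift_def)

lemma isCont_lift: "is_lift f F \<Longrightarrow> isCont F x"
  using is_liftD(1) continuous_on_eq_continuous_at[of UNIV F] by auto

lemma lift_less_iff: "is_lift f F \<Longrightarrow> F x < F y \<longleftrightarrow> x < y"
  by (simp add: is_liftD strict_mono_less)

lemma lift_eq_iff: "is_lift f F \<Longrightarrow> F x = F y \<longleftrightarrow> x = y"
  by (simp add: is_liftD strict_mono_eq)

lemma lift_add_of_nat: "is_lift f F \<Longrightarrow> F (x + of_nat k) = F x + of_nat k"
  by (induction k) (auto simp: is_liftD(3) add.assoc[symmetric] add.commute[of 1])

lemma lift_add_of_int: "is_lift f F \<Longrightarrow> F (x + of_int k) = F x + of_int k"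
  using lift_add_of_nat[of f F x "nat k"] lift_add_of_nat[of f F "x + of_int k" "nat (- k)"]
  by (cases "k \<ge> 0") auto

lemma is_lift_shift: "is_lift f F \<Longrightarrow> is_lift f (\<lambda>x. F x + of_int k)"
  unfolding is_lift_def by (auto intro!: continuous_intros simp: strict_mono_def)

lemma is_lift_id: "is_lift id (\<lambda>x. x)"
  by (simp add: is_lift_def strict_mono_def)

lemma is_lift_comp:
  assumes f: "is_lift f F" and g: "is_lift g G"
  shows "is_lift (f \<circ> g) (F \<circ> G)"
proof -
  have "continuous_on UNIV (F \<circ> G)"
    using is_liftD(1)[OF f] is_liftD(1)[OF g]
    by (meson continuous_on_compose continuous_on_subset subset_UNIV)
  then show ?thesis
    using f g unfolding is_lift_def by (auto simp: strict_mono_def)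
qed

lemma is_lift_funpow: "is_lift f F \<Longrightarrow> is_lift (f ^^ k) (F ^^ k)"
  using is_lift_id by (induction k) (auto simp: is_lift_comp id_def)

lemma surj_lift:
  assumes F: "is_lift f F"
  shows "surj F"
proof -
  have "\<exists>x. F x = y" for y
  proof -
    define k where "k = \<lfloor>y - F 0\<rfloor>"
    have "F (0 + of_int k) \<le> y" "y \<le> F (0 + of_int (k + 1))"
      unfolding lift_add_of_int[OF F] k_def by linarith+
    moreover have "(0 :: real) + of_int k \<le> 0 + of_int (k + 1)"
      by simp
    ultimately show ?thesis
      using IVT'[of F "0 + of_int k" y "0 + of_int (k + 1)"] continuous_on_subset[OF is_liftD(1)[OF F]]
      by blast
  qed
  then show ?thesis
    by (metis surjI)
qed

lemma bij_of_lift: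
  assumes F: "is_lift f F"
  shows "bij f"
proof (rule bijI)
  show "inj f"
  proof (rule injI)
    fix x y assume eq: "f x = f y"
    obtain s t where st: "to_circle s = x" "to_circle t = y"
      by (metis to_circle_representative)
    have "F s - F t \<in> \<int>"
      using eq by (simp flip: st add: is_liftD(4)[OF F] to_circle_eq_iff)
    then obtain k where "F s = F t + of_int k"
      by (metis Ints_cases diff_add_cancel add.commute)
    then have "s = t + of_int k"
      using lift_add_of_int[OF F] lift_eq_iff[OF F] by metis
    then show "x = y"
      by (simp flip: st)
  qed
  show "surj f"
  proof (rule surjI)
    fix y
    have "to_circle (rep_circle y) = y"
      by (rule Quotient3_abs_rep[OF Quotient3_circle])
    then show "f (to_circle (inv F (rep_circle y))) = y"
      by (simp add: is_liftD(4)[OF F] surj_f_inv_f[OF surj_lift[OF F]])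
  qed
qed

text \<open>The difference of two lifts is continuous and integer valued.\<close>

lemma lift_unique:
  assumes F: "is_lift f F" and G: "is_lift f G"
  obtains k where "\<And>x. G x = F x + of_int k"
proof -
  have int: "G x - F x \<in> \<int>" for x
    using is_liftD(4)[OF F] is_liftD(4)[OF G] by (metis to_circle_eq_iff)
  have cont: "isCont (\<lambda>x. G x - F x) x" for x
    by (intro continuous_intros isCont_lift[OF F] isCont_lift[OF G])
  have const: "G x - F x = G 0 - F 0" for x
  proof (rule connected_local_const[where f = "\<lambda>x. G x - F x" and A = UNIV])
    show "\<forall>a\<in>UNIV. \<forall>\<^sub>F b in at a. G a - F a = G b - F b"
    proof
      fix a
      have "\<forall>\<^sub>F b in at a. dist (G b - F b) (G a - F a) < 1"
        using cont[of a] unfolding isCont_def by (rule tendstoD) simp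
      then show "\<forall>\<^sub>F b in at a. G a - F a = G b - F b"
      proof eventually_elim
        case (elim b)
        then show ?case
          using Ints_abs_less_1[of "G b - F b - (G a - F a)"] Ints_diff[OF int int]
          by (simp add: dist_real_def)
      qed
    qed
  qed auto
  obtain k where "G 0 - F 0 = of_int k"
    using int[of 0] by (auto elim: Ints_cases)
  then have "G x = F x + of_int k" for x
    using const[of x] by simp
  then show thesis
    by (rule that)
qed

lemma continuous_of_lift:
  assumes "is_lift h H"
  shows "continuous_on UNIV h"
proof -
  have "open (h -` U)" if "open U" for U
  proof -
    have "to_circle -` (h -` U) = H -` (to_circle -` U)"
      using is_liftD(4)[OF assms] by auto
    then show ?thesis
      using that is_liftD(1)[OF assms] unfolding open_circle_def by (simp add: continuous_on_open_vimage)
  qed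
  then show ?thesis
    by (simp add: continuous_on_open_vimage)
qed

lemma borel_measurable_of_lift: "is_lift f F \<Longrightarrow> f \<in> borel_measurable borel"
  by (intro borel_measurable_continuous_onI continuous_of_lift)

text \<open>A lift is a homeomorphism of the line, and the circle carries the quotient topology; so both
  the induced map and its inverse are continuous.\<close>

lemma lift_induces_homeo:
  assumes cont: "continuous_on UNIV H" and mono: "strict_mono H" and deg: "\<And>x. H (x + 1) = H x + 1"
  obtains h where "is_lift h H" "orientation_preserving_homeo h"
proof -
  have shift: "H (x + of_int k) = H x + of_int k" for x k
  proof -
    have nat: "H (x + of_nat m) = H x + of_nat m" for x m
      by (induction m) (auto simp: deg add.assoc[symmetric] add.commute[of 1])
    show ?thesis
      using nat[of x "nat k"] nat[of "x + of_int k" "nat (- k)"] by (cases "k \<ge> 0") auto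
  qed
  define h where "h = to_circle \<circ> H \<circ> rep_circle"
  have "h (to_circle x) = to_circle (H x)" for x
  proof -
    have "to_circle (rep_circle (to_circle x)) = to_circle x"
      by (rule Quotient3_abs_rep[OF Quotient3_circle])
    then obtain k where "rep_circle (to_circle x) = x + of_int k"
      by (rule to_circle_eqE)
    then show ?thesis
      by (simp add: h_def shift)
  qed
  then have lift: "is_lift h H"
    using assms by (simp add: is_lift_def)
  have "open (inv h -` U)" if "open U" for U
  proof -
    have "to_circle -` (inv h -` U) = inv H -` (to_circle -` U)"
    proof (rule set_eqI)
      fix x
      have "inv h (to_circle x) = to_circle (inv H x)"
      proof -
        have "h (to_circle (inv H x)) = to_circle x"
          by (simp add: is_liftD(4)[OF lift] surj_f_inv_f[OF surj_lift[OF lift]])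
        then show ?thesis
          using bij_of_lift[OF lift] by (metis bij_inv_eq_iff)
      qed
      then show "x \<in> to_circle -` (inv h -` U) \<longleftrightarrow> x \<in> inv H -` (to_circle -` U)"
        by simp
    qed
    moreover have "continuous_on UNIV (inv H)"
    proof -
      have "isCont (inv H) y" for y
      proof -
        have "isCont (inv H) (H (inv H y))"
          by (rule isCont_inverse_function2[of "inv H y - 1" _ "inv H y + 1"])
             (use mono isCont_lift[OF lift] in \<open>auto simp: inv_f_f strict_mono_imp_inj_on\<close>)
        then show ?thesis
          using surj_lift[OF lift] by (simp add: surj_f_inv_f)
      qed
      then show ?thesis
        by (simp add: continuous_on_eq_continuous_at)
    qed
    ultimately show ?thesis
      using that unfolding open_circle_def by (simp add: continuous_on_open_vimage)
  qed
  then have "continuous_on UNIV (inv h)"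
    by (simp add: continuous_on_open_vimage)
  then have "homeomorphism UNIV UNIV h (inv h)"
    using continuous_of_lift[OF lift] bij_of_lift[OF lift] bij_imp_bij_inv[OF bij_of_lift[OF lift]]
    by (simp add: homeomorphism_def bij_is_surj bij_is_inj surj_f_inv_f)
  with lift that show thesis
    unfolding orientation_preserving_homeo_def by blast
qed

section \<open>Rotation numbers\<close>

text \<open>Two orbits of a lift that start within distance one of each other stay so, because lifts are
  increasing and commute with integer translations; hence the displacement \<open>F\<^sup>m x - x\<close> depends on
  \<open>x\<close> only up to an error of at most \<open>1\<close>.\<close>

lemma lift_displacement_close:
  assumes F: "is_lift f F"
  shows "\<bar>(F x - x) - (F y - y)\<bar> \<le> 1"
proof -
  \<comment> \<open>\<open>x\<close> lies between two consecutive integer translates of \<open>y\<close>.\<close>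
  define k where "k = \<lfloor>x - y\<rfloor>"
  have "F (y + of_int k) \<le> F x" "F x \<le> F (y + of_int (k + 1))"
    using strict_mono_less_eq[OF is_liftD(2)[OF F]] unfolding k_def by (auto; linarith)+
  then have "F y + of_int k \<le> F x" "F x \<le> F y + of_int (k + 1)"
    unfolding lift_add_of_int[OF F] by auto
  moreover have "of_int k \<le> x - y" "x - y \<le> of_int k + 1"
    unfolding k_def by linarith+
  ultimately show ?thesis
    by (simp add: abs_le_iff)
qed

lemma lift_iterate_displacement:
  assumes F: "is_lift f F"
  shows "\<bar>((F ^^ (m * n)) x - x) - real n * ((F ^^ m) y - y)\<bar> \<le> real n"
proof (induction n)
  case (Suc n)
  have "(F ^^ (m * Suc n)) x = (F ^^ m) ((F ^^ (m * n)) x)"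
    by (simp add: funpow_add)
  then have "((F ^^ (m * Suc n)) x - x) - real (Suc n) * ((F ^^ m) y - y)
      = (((F ^^ (m * n)) x - x) - real n * ((F ^^ m) y - y))
        + (((F ^^ m) ((F ^^ (m * n)) x) - (F ^^ (m * n)) x) - ((F ^^ m) y - y))"
    by (simp add: algebra_simps)
  then show ?case
    using Suc lift_displacement_close[OF is_lift_funpow[OF F], of m "(F ^^ (m * n)) x" y]
    by linarith
qed simp

text \<open>Comparing \<open>F\<^sup>m\<close> and \<open>F\<^sup>n\<close> through \<open>F\<^sup>m\<^sup>n\<close> shows that the mean displacements form a Cauchy
  sequence.\<close>

lemma lift_mean_displacement_close:
  assumes F: "is_lift f F" and "m > 0" "n > 0"
  shows "\<bar>((F ^^ m) x - x) / real m - ((F ^^ n) y - y) / real n\<bar> \<le> 1 / real m + 1 / real n"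
proof -
  define a where "a = (F ^^ m) x - x"
  define c where "c = (F ^^ n) y - y"
  define d where "d = (F ^^ (m * n)) x - x"
  have "\<bar>d - real n * a\<bar> \<le> real n" "\<bar>d - real m * c\<bar> \<le> real m"
    using lift_iterate_displacement[OF F, of m n x x] lift_iterate_displacement[OF F, of n m x y]
    by (simp_all add: a_def c_def d_def mult.commute)
  then have "\<bar>real n * a - real m * c\<bar> \<le> real n + real m"
    by linarith
  then have "\<bar>real n * a - real m * c\<bar> / (real m * real n) \<le> (real n + real m) / (real m * real n)"
    by (rule divide_right_mono) simp
  moreover have "a / real m - c / real n = (real n * a - real m * c) / (real m * real n)"
    "1 / real m + 1 / real n = (real n + real m) / (real m * real n)"
    using assms(2,3) by (simp_all add: field_simps)
  ultimately show ?thesis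
    unfolding a_def[symmetric] c_def[symmetric] by (simp add: abs_divide abs_mult)
qed

text \<open>The definite description in the definition of \<open>lift_rotation_number\<close> is meaningful because the limit
exists and, displacements of different points differing by at most \<open>1\<close>, is the same for all points.\<close>

lemma LIMSEQ_lift_rotation_number:
  assumes F: "is_lift f F"
  shows "(\<lambda>m. ((F ^^ m) x - x) / real m) \<longlonglongrightarrow> lift_rotation_number F"
proof -
  define s where "s x m = ((F ^^ m) x - x) / real m" for x m
  have close: "\<bar>s x m - s y n\<bar> \<le> 1 / real m + 1 / real n" if "m > 0" "n > 0" for x y m n
    unfolding s_def by (rule lift_mean_displacement_close[OF F that])
  have "Cauchy (s 0)"
  proof (rule metric_CauchyI)
    fix e :: real assume "0 < e"
    then obtain M where M: "M > 0" "1 / real M < e / 2"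
      by (metis half_gt_zero inverse_eq_divide ex_inverse_of_nat_less)
    have "dist (s 0 m) (s 0 n) < e" if "m \<ge> M" "n \<ge> M" for m n
    proof -
      have "1 / real m \<le> 1 / real M" "1 / real n \<le> 1 / real M"
        using M(1) that by (simp_all add: frac_le)
      then show ?thesis
        using close[of m n 0 0] M that unfolding dist_real_def by linarith
    qed
    then show "\<exists>M. \<forall>m\<ge>M. \<forall>n\<ge>M. dist (s 0 m) (s 0 n) < e"
      by blast
  qed
  then obtain \<rho> where \<rho>: "s 0 \<longlonglongrightarrow> \<rho>"
    using Cauchy_convergent convergent_def by blast
  have "s x \<longlonglongrightarrow> \<rho>" for x
  proof -
    have lim: "(\<lambda>m. 2 * (1 / real m)) \<longlonglongrightarrow> 0"
      by (rule tendsto_mult_right_zero[OF lim_1_over_n])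
    have "(\<lambda>m. s x m - s 0 m) \<longlonglongrightarrow> 0"
    proof (rule tendsto_0_le[OF lim, where K = 1])
      show "\<forall>\<^sub>F m in sequentially. norm (s x m - s 0 m) \<le> norm (2 * (1 / real m)) * 1"
        using eventually_gt_at_top[of 0]
      proof eventually_elim
        case (elim m)
        then show ?case
          using close[of m m x 0] by simp
      qed
    qed
    from tendsto_add[OF this \<rho>] show ?thesis
      by simp
  qed
  then have "\<exists>!\<rho>. \<forall>x. s x \<longlonglongrightarrow> \<rho>"
    by (meson LIMSEQ_unique)
  then have "\<forall>x. s x \<longlonglongrightarrow> (THE \<rho>. \<forall>x. s x \<longlonglongrightarrow> \<rho>)"
    by (rule theI')
  then show ?thesis
    unfolding lift_rotation_number_def s_def by blast
qed

lemma lift_shift_funpow: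
  assumes F: "is_lift f F"
  shows "((\<lambda>x. F x + of_int k) ^^ m) x = (F ^^ m) x + of_int (int m * k)"
proof (induction m)
  case (Suc m)
  show ?case
    unfolding funpow.simps comp_apply Suc lift_add_of_int[OF F] by (simp add: algebra_simps)
qed simp

lemma lift_rotation_number_shift:
  assumes F: "is_lift f F"
  shows "lift_rotation_number (\<lambda>x. F x + of_int k) = lift_rotation_number F + of_int k"
proof (rule LIMSEQ_unique)
  show "(\<lambda>m. (((\<lambda>x. F x + of_int k) ^^ m) 0 - 0) / real m) \<longlonglongrightarrow> lift_rotation_number (\<lambda>x. F x + of_int k)"
    by (rule LIMSEQ_lift_rotation_number[OF is_lift_shift[OF F]])
  have "(\<lambda>m. ((F ^^ m) 0 - 0) / real m + of_int k) \<longlonglongrightarrow> lift_rotation_number F + of_int k"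
    by (intro tendsto_intros LIMSEQ_lift_rotation_number[OF F])
  then show "(\<lambda>m. (((\<lambda>x. F x + of_int k) ^^ m) 0 - 0) / real m) \<longlonglongrightarrow> lift_rotation_number F + of_int k"
  proof (rule Lim_transform_eventually)
    show "\<forall>\<^sub>F m in sequentially. ((F ^^ m) 0 - 0) / real m + of_int k
        = (((\<lambda>x. F x + of_int k) ^^ m) 0 - 0) / real m"
      using eventually_gt_at_top[of 0]
      by eventually_elim (simp add: lift_shift_funpow[OF F] field_simps)
  qed
qed

lemma rotation_number_eq:
  assumes F: "is_lift f F"
  shows "rotation_number f = to_circle (lift_rotation_number F)"
  unfolding rotation_number_def
proof (rule the_equality)
  show "\<exists>F'. is_lift f F' \<and> to_circle (lift_rotation_number F) = to_circle (lift_rotation_number F')"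
    using F by blast
next
  fix r assume "\<exists>G. is_lift f G \<and> r = to_circle (lift_rotation_number G)"
  then obtain G where G: "is_lift f G" "r = to_circle (lift_rotation_number G)"
    by blast
  obtain k where "\<And>x. G x = F x + of_int k"
    using lift_unique[OF F G(1)] by blast
  then have "G = (\<lambda>x. F x + of_int k)"
    by auto
  then show "r = to_circle (lift_rotation_number F)"
    by (simp add: G(2) lift_rotation_number_shift[OF F])
qed

text \<open>By periodicity, a displacement without zeros is bounded away from zero on the whole line, and
  then every orbit drifts off at a positive linear rate.\<close>

lemma fixed_point_of_zero_rotation_number:
  assumes G: "is_lift g G" and zero: "lift_rotation_number G = 0"
  shows "\<exists>c. G c = c"
proof (rule ccontr)
  assume no: "\<nexists>c. G c = c"
  define d where "d x = G x - x" for x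
  have cont: "continuous_on A d" for A
    unfolding d_def by (intro continuous_intros continuous_on_subset[OF is_liftD(1)[OF G]]) auto
  have per: "d (x + of_int k) = d x" for x k
    by (simp add: d_def lift_add_of_int[OF G])
  have cases: "(\<forall>x. d x > 0) \<or> (\<forall>x. d x < 0)"
  proof (rule ccontr)
    assume "\<not> ?thesis"
    then obtain x y where "d x \<le> 0" "0 \<le> d y"
      by (meson not_less)
    moreover have "connected (d ` UNIV)"
      by (rule connected_continuous_image[OF cont connected_UNIV])
    ultimately have "0 \<in> d ` UNIV"
      unfolding connected_iff_interval by (meson rangeI)
    with no show False
      by (auto simp: d_def)
  qed
  have "\<exists>z\<in>{0..1}. \<forall>y\<in>{0..1}. \<bar>d z\<bar> \<le> \<bar>d y\<bar>"
    by (rule continuous_attains_inf) (auto intro!: continuous_intros cont)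
  then obtain z where z: "\<forall>y\<in>{0..1}. \<bar>d z\<bar> \<le> \<bar>d y\<bar>"
    by blast
  define e where "e = \<bar>d z\<bar>"
  have "e > 0"
    using no by (simp add: e_def d_def)
  have e: "e \<le> \<bar>d x\<bar>" for x
  proof -
    have "frac x = x + of_int (- \<lfloor>x\<rfloor>)"
      by (simp add: frac_def)
    then have "d (frac x) = d x"
      by (simp only: per)
    then show ?thesis
      using z frac_ge_0[of x] frac_lt_1[of x] unfolding e_def by (metis atLeastAtMost_iff less_imp_le)
  qed
  have far: "\<bar>(G ^^ m) 0\<bar> \<ge> real m * e" for m
  proof -
    have step: "(G ^^ Suc m) 0 = (G ^^ m) 0 + d ((G ^^ m) 0)" for m
      by (simp add: d_def)
    show ?thesis
      using cases
    proof
      assume pos: "\<forall>x. d x > 0"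
      have "(G ^^ m) 0 \<ge> real m * e"
      proof (induction m)
        case (Suc m)
        have "e \<le> d ((G ^^ m) 0)"
          using e pos by (metis abs_of_pos)
        then show ?case
          using Suc unfolding step by (simp add: algebra_simps)
      qed simp
      then show ?thesis
        by linarith
    next
      assume neg: "\<forall>x. d x < 0"
      have "(G ^^ m) 0 \<le> - (real m * e)"
      proof (induction m)
        case (Suc m)
        have "d ((G ^^ m) 0) \<le> - e"
          using e[of "(G ^^ m) 0"] neg by (simp add: abs_of_neg)
        then show ?case
          using Suc unfolding step by (simp add: algebra_simps)
      qed simp
      then show ?thesis
        by linarith
    qed
  qed
  have "(\<lambda>m. \<bar>((G ^^ m) 0 - 0) / real m\<bar>) \<longlonglongrightarrow> \<bar>0\<bar>"
    using LIMSEQ_lift_rotation_number[OF G, of 0] unfolding zero by (rule tendsto_rabs)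
  moreover have "\<forall>\<^sub>F m in sequentially. e \<le> \<bar>((G ^^ m) 0 - 0) / real m\<bar>"
    using eventually_gt_at_top[of 0]
    by eventually_elim (use far in \<open>simp add: field_simps\<close>)
  ultimately have "e \<le> \<bar>0\<bar>"
    by (rule tendsto_lowerbound) simp
  with \<open>e > 0\<close> show False
    by simp
qed

text \<open>Among the lifts one has rotation number exactly \<open>p / Q\<close>, and then its \<open>Q\<close>-th iterate shifted by
\<open>- p\<close> has rotation number \<open>0\<close>.\<close>

lemma periodic_point_of_rational_rotation_number:
  assumes F0: "is_lift f F0" and "Q > 0"
    and rot: "rotation_number f = to_circle (real_of_int p / real Q)"
  obtains F c where "is_lift f F" "(F ^^ Q) c = c + of_int p"
proof -
  have "to_circle (real_of_int p / real Q) = to_circle (lift_rotation_number F0)"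
    using rotation_number_eq[OF F0] rot by simp
  then obtain k where k: "real_of_int p / real Q = lift_rotation_number F0 + of_int k"
    by (rule to_circle_eqE)
  define F where "F x = F0 x + of_int k" for x
  have F: "is_lift f F"
    unfolding F_def by (rule is_lift_shift[OF F0])
  have \<rho>: "lift_rotation_number F = real_of_int p / real Q"
    using k lift_rotation_number_shift[OF F0] unfolding F_def by simp
  define G where "G x = (F ^^ Q) x + of_int (- p)" for x
  have G: "is_lift (f ^^ Q) G"
    unfolding G_def by (rule is_lift_shift[OF is_lift_funpow[OF F]])
  have "lift_rotation_number G = 0"
  proof (rule LIMSEQ_unique)
    show "(\<lambda>m. ((G ^^ m) 0 - 0) / real m) \<longlonglongrightarrow> lift_rotation_number G"
      by (rule LIMSEQ_lift_rotation_number[OF G])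
    have "filterlim (\<lambda>m. Q * m) at_top sequentially"
      using \<open>Q > 0\<close> by (simp add: mult_nat_left_at_top)
    from filterlim_compose[OF LIMSEQ_lift_rotation_number[OF F, of 0] this]
    have "(\<lambda>m. ((F ^^ (Q * m)) 0 - 0) / real (Q * m)) \<longlonglongrightarrow> real_of_int p / real Q"
      by (simp add: \<rho>)
    then have "(\<lambda>m. real Q * (((F ^^ (Q * m)) 0 - 0) / real (Q * m)) - of_int p) \<longlonglongrightarrow>
        real Q * (real_of_int p / real Q) - of_int p"
      by (rule tendsto_diff[OF tendsto_mult[OF tendsto_const] tendsto_const])
    then have "(\<lambda>m. real Q * (((F ^^ (Q * m)) 0 - 0) / real (Q * m)) - of_int p) \<longlonglongrightarrow> 0"
      using \<open>Q > 0\<close> by simp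
    then show "(\<lambda>m. ((G ^^ m) 0 - 0) / real m) \<longlonglongrightarrow> 0"
    proof (rule Lim_transform_eventually)
      show "\<forall>\<^sub>F m in sequentially. real Q * (((F ^^ (Q * m)) 0 - 0) / real (Q * m)) - of_int p
          = ((G ^^ m) 0 - 0) / real m"
        using eventually_gt_at_top[of 0]
      proof eventually_elim
        case (elim m)
        have "(G ^^ m) 0 = ((F ^^ Q) ^^ m) 0 + of_int (int m * (- p))"
          unfolding G_def by (rule lift_shift_funpow[OF is_lift_funpow[OF F]])
        then have "(G ^^ m) 0 = (F ^^ (Q * m)) 0 - real m * of_int p"
          by (simp add: funpow_mult mult.commute)
        with elim \<open>Q > 0\<close> show ?case
          by (simp add: field_simps)
      qed
    qed
  qed
  then obtain c where "G c = c"
    using fixed_point_of_zero_rotation_number[OF G] by blast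
  then have "(F ^^ Q) c = c + of_int p"
    by (simp add: G_def)
  with F show thesis
    by (rule that)
qed

section \<open>One-sided slopes of piecewise linear lifts\<close>

definition right_slope :: "(real \<Rightarrow> real) \<Rightarrow> real \<Rightarrow> real \<Rightarrow> bool"
  where "right_slope F t r \<longleftrightarrow> 0 < r \<and> (\<forall>\<^sub>F x in at_right t. F x = F t + r * (x - t))"

definition left_slope :: "(real \<Rightarrow> real) \<Rightarrow> real \<Rightarrow> real \<Rightarrow> bool"
  where "left_slope F t l \<longleftrightarrow> 0 < l \<and> (\<forall>\<^sub>F x in at_left t. F x = F t + l * (x - t))"

text \<open>The local form of piecewise linearity. By periodicity and compactness it leaves room for
  finitely many break points on the circle only; it is stable under composition, where an enumeration
  of break points would have to be rebuilt.\<close>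

definition pl_lift :: "(circle \<Rightarrow> circle) \<Rightarrow> (real \<Rightarrow> real) \<Rightarrow> bool"
  where "pl_lift f F \<longleftrightarrow> is_lift f F \<and> (\<forall>t. \<exists>l r. left_slope F t l \<and> right_slope F t r)"

lemma pl_lift_is_lift: "pl_lift f F \<Longrightarrow> is_lift f F"
  by (simp add: pl_lift_def)

lemma right_slopeE:
  assumes "right_slope F t r"
  obtains e where "e > 0" "\<And>x. t \<le> x \<Longrightarrow> x < t + e \<Longrightarrow> F x = F t + r * (x - t)"
proof -
  from assms obtain u where u: "u > t" "\<forall>y>t. y < u \<longrightarrow> F y = F t + r * (y - t)"
    by (auto simp: right_slope_def eventually_at_right_field)
  show thesis
  proof
    show "u - t > 0"
      using u by simp
    show "F x = F t + r * (x - t)" if "t \<le> x" "x < t + (u - t)" for x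
      using u that by (cases "x = t") auto
  qed
qed

lemma left_slopeE:
  assumes "left_slope F t r"
  obtains e where "e > 0" "\<And>x. x \<le> t \<Longrightarrow> t - e < x \<Longrightarrow> F x = F t + r * (x - t)"
proof -
  from assms obtain u where u: "u < t" "\<forall>y>u. y < t \<longrightarrow> F y = F t + r * (y - t)"
    by (auto simp: left_slope_def eventually_at_left_field)
  show thesis
  proof
    show "t - u > 0"
      using u by simp
    show "F x = F t + r * (x - t)" if "x \<le> t" "t - (t - u) < x" for x
      using u that by (cases "x = t") auto
  qed
qed

lemma right_slopeI:
  assumes "r > 0" "e > 0" "\<And>x. t < x \<Longrightarrow> x < t + e \<Longrightarrow> F x = F t + r * (x - t)"
  shows "right_slope F t r"
  unfolding right_slope_def eventually_at_right_field
  using assms by (intro conjI exI[of _ "t + e"]) auto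

lemma left_slopeI:
  assumes "r > 0" "e > 0" "\<And>x. x < t \<Longrightarrow> t - e < x \<Longrightarrow> F x = F t + r * (x - t)"
  shows "left_slope F t r"
  unfolding left_slope_def eventually_at_left_field
  using assms by (intro conjI exI[of _ "t - e"]) auto

lemma right_slope_comp:
  assumes G: "right_slope G t s" and F: "right_slope F (G t) r"
  shows "right_slope (F \<circ> G) t (r * s)"
proof -
  have pos: "s > 0" "r > 0"
    using assms by (auto simp: right_slope_def)
  obtain d where d: "d > 0" "\<And>x. t \<le> x \<Longrightarrow> x < t + d \<Longrightarrow> G x = G t + s * (x - t)"
    using right_slopeE[OF G] by blast
  obtain e where e: "e > 0" "\<And>y. G t \<le> y \<Longrightarrow> y < G t + e \<Longrightarrow> F y = F (G t) + r * (y - G t)"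
    using right_slopeE[OF F] by blast
  show ?thesis
  proof (rule right_slopeI[of _ "min d (e / s)"])
    fix x assume x: "t < x" "x < t + min d (e / s)"
    then have "x - t < e / s" "0 < x - t"
      by auto
    then have "s * (x - t) < e" "0 < s * (x - t)"
      using pos by (auto simp: pos_less_divide_eq mult.commute)
    then show "(F \<circ> G) x = (F \<circ> G) t + r * s * (x - t)"
      using d(2)[of x] e(2)[of "G x"] x by simp
  qed (use pos d(1) e(1) in auto)
qed

lemma left_slope_comp:
  assumes G: "left_slope G t s" and F: "left_slope F (G t) r"
  shows "left_slope (F \<circ> G) t (r * s)"
proof -
  have pos: "s > 0" "r > 0"
    using assms by (auto simp: left_slope_def)
  obtain d where d: "d > 0" "\<And>x. x \<le> t \<Longrightarrow> t - d < x \<Longrightarrow> G x = G t + s * (x - t)"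
    using left_slopeE[OF G] by blast
  obtain e where e: "e > 0" "\<And>y. y \<le> G t \<Longrightarrow> G t - e < y \<Longrightarrow> F y = F (G t) + r * (y - G t)"
    using left_slopeE[OF F] by blast
  show ?thesis
  proof (rule left_slopeI[of _ "min d (e / s)"])
    fix x assume x: "x < t" "t - min d (e / s) < x"
    then have "t - x < e / s" "0 < t - x"
      by auto
    then have "s * (t - x) < e" "0 < s * (t - x)"
      using pos by (auto simp: pos_less_divide_eq mult.commute)
    then have "s * (x - t) > - e" "s * (x - t) < 0"
      by (auto simp: algebra_simps)
    then show "(F \<circ> G) x = (F \<circ> G) t + r * s * (x - t)"
      using d(2)[of x] e(2)[of "G x"] x by simp
  qed (use pos d(1) e(1) in auto)
qed

lemma right_slope_average:
  assumes "finite A" "A \<noteq> {}" "\<And>i. i \<in> A \<Longrightarrow> right_slope (F i) t (r i)" "c > 0"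
  shows "right_slope (\<lambda>x. (\<Sum>i\<in>A. F i x) / c) t ((\<Sum>i\<in>A. r i) / c)"
  unfolding right_slope_def
proof
  show "0 < (\<Sum>i\<in>A. r i) / c"
    using assms by (intro divide_pos_pos sum_pos) (auto simp: right_slope_def)
  have "\<forall>\<^sub>F x in at_right t. \<forall>i\<in>A. F i x = F i t + r i * (x - t)"
    using assms by (intro eventually_ball_finite) (auto simp: right_slope_def)
  then show "\<forall>\<^sub>F x in at_right t. (\<Sum>i\<in>A. F i x) / c = (\<Sum>i\<in>A. F i t) / c + (\<Sum>i\<in>A. r i) / c * (x - t)"
  proof eventually_elim
    case (elim x)
    then have "(\<Sum>i\<in>A. F i x) = (\<Sum>i\<in>A. F i t) + (\<Sum>i\<in>A. r i) * (x - t)"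
      unfolding sum_distrib_right sum.distrib[symmetric] by (intro sum.cong) auto
    then show ?case
      by (simp add: add_divide_distrib)
  qed
qed

lemma left_slope_average:
  assumes "finite A" "A \<noteq> {}" "\<And>i. i \<in> A \<Longrightarrow> left_slope (F i) t (r i)" "c > 0"
  shows "left_slope (\<lambda>x. (\<Sum>i\<in>A. F i x) / c) t ((\<Sum>i\<in>A. r i) / c)"
  unfolding left_slope_def
proof
  show "0 < (\<Sum>i\<in>A. r i) / c"
    using assms by (intro divide_pos_pos sum_pos) (auto simp: left_slope_def)
  have "\<forall>\<^sub>F x in at_left t. \<forall>i\<in>A. F i x = F i t + r i * (x - t)"
    using assms by (intro eventually_ball_finite) (auto simp: left_slope_def)
  then show "\<forall>\<^sub>F x in at_left t. (\<Sum>i\<in>A. F i x) / c = (\<Sum>i\<in>A. F i t) / c + (\<Sum>i\<in>A. r i) / c * (x - t)"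
  proof eventually_elim
    case (elim x)
    then have "(\<Sum>i\<in>A. F i x) = (\<Sum>i\<in>A. F i t) + (\<Sum>i\<in>A. r i) * (x - t)"
      unfolding sum_distrib_right sum.distrib[symmetric] by (intro sum.cong) auto
    then show ?case
      by (simp add: add_divide_distrib)
  qed
qed

lemma right_slope_translate:
  assumes F: "is_lift f F" and r: "right_slope F t r"
  shows "right_slope F (t + of_int k) r"
proof -
  obtain e where e: "e > 0" "\<And>x. t \<le> x \<Longrightarrow> x < t + e \<Longrightarrow> F x = F t + r * (x - t)"
    using right_slopeE[OF r] by blast
  show ?thesis
  proof (rule right_slopeI[of _ e])
    fix x assume "t + of_int k < x" "x < t + of_int k + e"
    then have "F (x - of_int k) = F t + r * (x - of_int k - t)"
      using e(2)[of "x - of_int k"] by auto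
    then show "F x = F (t + of_int k) + r * (x - (t + of_int k))"
      using lift_add_of_int[OF F, of "x - of_int k" k] lift_add_of_int[OF F, of t k]
      by (simp add: algebra_simps)
  qed (use r e(1) in \<open>auto simp: right_slope_def\<close>)
qed

lemma left_slope_translate:
  assumes F: "is_lift f F" and r: "left_slope F t r"
  shows "left_slope F (t + of_int k) r"
proof -
  obtain e where e: "e > 0" "\<And>x. x \<le> t \<Longrightarrow> t - e < x \<Longrightarrow> F x = F t + r * (x - t)"
    using left_slopeE[OF r] by blast
  show ?thesis
  proof (rule left_slopeI[of _ e])
    fix x assume "x < t + of_int k" "t + of_int k - e < x"
    then have "F (x - of_int k) = F t + r * (x - of_int k - t)"
      using e(2)[of "x - of_int k"] by auto
    then show "F x = F (t + of_int k) + r * (x - (t + of_int k))"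
      using lift_add_of_int[OF F, of "x - of_int k" k] lift_add_of_int[OF F, of t k]
      by (simp add: algebra_simps)
  qed (use r e(1) in \<open>auto simp: left_slope_def\<close>)
qed

lemma right_slope_imp_derivative:
  assumes "right_slope F t r"
  shows "(F has_real_derivative r) (at_right t)"
  unfolding has_field_derivative_iff
proof (rule tendsto_eventually)
  have "\<forall>\<^sub>F x in at_right t. x \<noteq> t"
    by (simp add: eventually_at_filter)
  moreover have "\<forall>\<^sub>F x in at_right t. F x = F t + r * (x - t)"
    using assms by (simp add: right_slope_def)
  ultimately show "\<forall>\<^sub>F x in at_right t. (F x - F t) / (x - t) = r"
    by eventually_elim simp
qed

lemma left_slope_imp_derivative:
  assumes "left_slope F t r"
  shows "(F has_real_derivative r) (at_left t)"
  unfolding has_field_derivative_iff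
proof (rule tendsto_eventually)
  have "\<forall>\<^sub>F x in at_left t. x \<noteq> t"
    by (simp add: eventually_at_filter)
  moreover have "\<forall>\<^sub>F x in at_left t. F x = F t + r * (x - t)"
    using assms by (simp add: left_slope_def)
  ultimately show "\<forall>\<^sub>F x in at_left t. (F x - F t) / (x - t) = r"
    by eventually_elim simp
qed

lemma right_derivative_unique:
  "(F has_real_derivative a) (at_right t) \<Longrightarrow> (F has_real_derivative b) (at_right t) \<Longrightarrow> a = b" for t :: real
  unfolding has_field_derivative_iff by (rule tendsto_unique) auto

lemma left_derivative_unique:
  "(F has_real_derivative a) (at_left t) \<Longrightarrow> (F has_real_derivative b) (at_left t) \<Longrightarrow> a = b" for t :: real
  unfolding has_field_derivative_iff by (rule tendsto_unique) auto

text \<open>All lifts of a map and all representatives of a point see the same one-sided derivative, since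
  they differ by integer translations.\<close>

lemma deriv_right_eq:
  assumes F: "is_lift f F" and r: "right_slope F t r"
  shows "deriv_right f (to_circle t) = r"
  unfolding deriv_right_def
proof (rule the_equality)
  show "\<exists>F' t'. is_lift f F' \<and> to_circle t' = to_circle t \<and> (F' has_real_derivative r) (at_right t')"
    using F right_slope_imp_derivative[OF r] by blast
next
  fix D assume "\<exists>G s. is_lift f G \<and> to_circle s = to_circle t \<and> (G has_real_derivative D) (at_right s)"
  then obtain G s where G: "is_lift f G" "to_circle s = to_circle t" "(G has_real_derivative D) (at_right s)"
    by blast
  obtain j where j: "s = t + of_int j"
    using to_circle_eqE[OF G(2)] .
  obtain k where "\<And>x. F x = G x + of_int k"
    using lift_unique[OF G(1) F] by blast
  then have "F = (\<lambda>x. G x + of_int k)"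
    by (rule ext)
  moreover have "((\<lambda>x. G x + of_int k) has_real_derivative D + 0) (at_right s)"
    by (intro derivative_intros G(3))
  ultimately have "(F has_real_derivative D) (at_right s)"
    by simp
  moreover have "(F has_real_derivative r) (at_right s)"
    unfolding j by (intro right_slope_imp_derivative right_slope_translate[OF F] r)
  ultimately show "D = r"
    by (rule right_derivative_unique)
qed

lemma deriv_left_eq:
  assumes F: "is_lift f F" and r: "left_slope F t r"
  shows "deriv_left f (to_circle t) = r"
  unfolding deriv_left_def
proof (rule the_equality)
  show "\<exists>F' t'. is_lift f F' \<and> to_circle t' = to_circle t \<and> (F' has_real_derivative r) (at_left t')"
    using F left_slope_imp_derivative[OF r] by blast
next
  fix D assume "\<exists>G s. is_lift f G \<and> to_circle s = to_circle t \<and> (G has_real_derivative D) (at_left s)"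
  then obtain G s where G: "is_lift f G" "to_circle s = to_circle t" "(G has_real_derivative D) (at_left s)"
    by blast
  obtain j where j: "s = t + of_int j"
    using to_circle_eqE[OF G(2)] .
  obtain k where "\<And>x. F x = G x + of_int k"
    using lift_unique[OF G(1) F] by blast
  then have "F = (\<lambda>x. G x + of_int k)"
    by (rule ext)
  moreover have "((\<lambda>x. G x + of_int k) has_real_derivative D + 0) (at_left s)"
    by (intro derivative_intros G(3))
  ultimately have "(F has_real_derivative D) (at_left s)"
    by simp
  moreover have "(F has_real_derivative r) (at_left s)"
    unfolding j by (intro left_slope_imp_derivative left_slope_translate[OF F] r)
  ultimately show "D = r"
    by (rule left_derivative_unique)
qed

lemma pl_right_slope:
  assumes "pl_lift f F"
  shows "right_slope F t (deriv_right f (to_circle t))"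
proof -
  obtain r where "right_slope F t r"
    using assms unfolding pl_lift_def by blast
  with deriv_right_eq[OF pl_lift_is_lift[OF assms] this] show ?thesis
    by simp
qed

lemma pl_left_slope:
  assumes "pl_lift f F"
  shows "left_slope F t (deriv_left f (to_circle t))"
proof -
  obtain r where "left_slope F t r"
    using assms unfolding pl_lift_def by blast
  with deriv_left_eq[OF pl_lift_is_lift[OF assms] this] show ?thesis
    by simp
qed

lemma pl_deriv_pos:
  assumes "pl_lift f F"
  shows "deriv_right f x > 0" "deriv_left f x > 0"
proof -
  obtain t where t: "to_circle t = x"
    by (rule to_circle_representative)
  show "deriv_right f x > 0" "deriv_left f x > 0"
    using pl_right_slope[OF assms, of t] pl_left_slope[OF assms, of t]
    unfolding right_slope_def left_slope_def t by simp_all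
qed

lemma jump_pos: "pl_lift f F \<Longrightarrow> jump f x > 0"
  by (simp add: jump_def pl_deriv_pos)

lemma jump_eq_1_iff: "pl_lift f F \<Longrightarrow> jump f x = 1 \<longleftrightarrow> x \<notin> break_points f"
  using pl_deriv_pos(2)[of f F x] by (auto simp: jump_def break_points_def)

lemma pl_lift_id: "pl_lift id (\<lambda>x. x)"
  unfolding pl_lift_def
  by (auto simp: is_lift_id intro!: exI[of _ 1] right_slopeI[of 1 1] left_slopeI[of 1 1])

lemma pl_lift_comp:
  assumes f: "pl_lift f F" and g: "pl_lift g G"
  shows "pl_lift (f \<circ> g) (F \<circ> G)"
  unfolding pl_lift_def
  using is_lift_comp[OF pl_lift_is_lift[OF f] pl_lift_is_lift[OF g]]
    left_slope_comp[OF pl_left_slope[OF g] pl_left_slope[OF f]]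
    right_slope_comp[OF pl_right_slope[OF g] pl_right_slope[OF f]]
  by blast

lemma pl_lift_funpow: "pl_lift f F \<Longrightarrow> pl_lift (f ^^ k) (F ^^ k)"
  using pl_lift_id by (induction k) (auto simp: pl_lift_comp id_def)

lemma deriv_comp:
  assumes f: "pl_lift f F" and g: "pl_lift g G"
  shows "deriv_right (f \<circ> g) x = deriv_right f (g x) * deriv_right g x"
    "deriv_left (f \<circ> g) x = deriv_left f (g x) * deriv_left g x"
proof -
  obtain t where t: "to_circle t = x"
    by (rule to_circle_representative)
  have gx: "g x = to_circle (G t)"
    using is_liftD(4)[OF pl_lift_is_lift[OF g], of t] t by simp
  have FG: "is_lift (f \<circ> g) (F \<circ> G)"
    by (intro pl_lift_is_lift pl_lift_comp assms)
  show "deriv_right (f \<circ> g) x = deriv_right f (g x) * deriv_right g x"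
    using deriv_right_eq[OF FG right_slope_comp[OF pl_right_slope[OF g, of t] pl_right_slope[OF f]]]
    unfolding gx t .
  show "deriv_left (f \<circ> g) x = deriv_left f (g x) * deriv_left g x"
    using deriv_left_eq[OF FG left_slope_comp[OF pl_left_slope[OF g, of t] pl_left_slope[OF f]]]
    unfolding gx t .
qed

lemma deriv_id: "deriv_right id x = 1" "deriv_left id x = 1"
proof -
  obtain t where t: "to_circle t = x"
    by (rule to_circle_representative)
  have "right_slope (\<lambda>x. x) t 1" "left_slope (\<lambda>x. x) t 1"
    by (auto intro: right_slopeI[of 1 1] left_slopeI[of 1 1])
  then show "deriv_right id x = 1" "deriv_left id x = 1"
    using deriv_right_eq[OF is_lift_id] deriv_left_eq[OF is_lift_id] unfolding t[symmetric] by blast+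
qed

lemma deriv_funpow:
  assumes f: "pl_lift f F"
  shows "deriv_right (f ^^ k) x = (\<Prod>i<k. deriv_right f ((f ^^ i) x))"
    and "deriv_left (f ^^ k) x = (\<Prod>i<k. deriv_left f ((f ^^ i) x))"
  by (induction k)
    (simp_all add: deriv_id[unfolded id_def] id_def deriv_comp[OF f pl_lift_funpow[OF f]] mult.commute
      del: comp_apply)

lemma jump_funpow: "pl_lift f F \<Longrightarrow> jump (f ^^ k) x = (\<Prod>i<k. jump f ((f ^^ i) x))"
  by (simp add: jump_def deriv_funpow prod_dividef)

text \<open>By the chain rule the jump of \<open>f ^^ k\<close> at \<open>x\<close> is a product of jumps of \<open>f\<close> at the first \<open>k\<close> points of
the orbit of \<open>x\<close>, so where \<open>f ^^ k\<close> breaks, at least one of these is a break point of \<open>f\<close>.\<close>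

lemma finite_break_points_funpow:
  assumes f: "pl_lift f F" and fin: "finite (break_points f)"
  shows "finite (break_points (f ^^ k))"
proof (rule finite_subset)
  show "break_points (f ^^ k) \<subseteq> (\<Union>i<k. (f ^^ i) -` break_points f)"
  proof
    fix x assume "x \<in> break_points (f ^^ k)"
    then have "(\<Prod>i<k. jump f ((f ^^ i) x)) \<noteq> 1"
      using jump_eq_1_iff[OF pl_lift_funpow[OF f], of k x] by (simp add: jump_funpow[OF f])
    then have "\<exists>i<k. jump f ((f ^^ i) x) \<noteq> 1"
      by (meson lessThan_iff prod.neutral)
    then show "x \<in> (\<Union>i<k. (f ^^ i) -` break_points f)"
      using jump_eq_1_iff[OF f] by blast
  qed
  show "finite (\<Union>i<k. (f ^^ i) -` break_points f)"
    using bij_of_lift[OF is_lift_funpow[OF pl_lift_is_lift[OF f]]]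
    by (intro finite_UN_I finite_vimageI[OF fin]) (auto simp: bij_is_inj)
qed

text \<open>One-sided slopes of an average are averages of slopes; so where no summand breaks, neither does the
average.\<close>

lemma finite_break_points_average:
  assumes h: "is_lift h (\<lambda>x. (\<Sum>i\<in>A. F i x) / c)" and A: "finite A" "A \<noteq> {}" "c > 0"
    and g: "\<And>i. i \<in> A \<Longrightarrow> pl_lift (g i) (F i)" and fin: "\<And>i. i \<in> A \<Longrightarrow> finite (break_points (g i))"
  shows "pl_lift h (\<lambda>x. (\<Sum>i\<in>A. F i x) / c)" "finite (break_points h)"
proof -
  have r: "right_slope (\<lambda>x. (\<Sum>i\<in>A. F i x) / c) t ((\<Sum>i\<in>A. deriv_right (g i) (to_circle t)) / c)" for t
    using A g pl_right_slope by (intro right_slope_average) auto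
  have l: "left_slope (\<lambda>x. (\<Sum>i\<in>A. F i x) / c) t ((\<Sum>i\<in>A. deriv_left (g i) (to_circle t)) / c)" for t
    using A g pl_left_slope by (intro left_slope_average) auto
  show "pl_lift h (\<lambda>x. (\<Sum>i\<in>A. F i x) / c)"
    unfolding pl_lift_def using h l r by blast
  have "break_points h \<subseteq> (\<Union>i\<in>A. break_points (g i))"
  proof
    fix x assume x: "x \<in> break_points h"
    obtain t where t: "to_circle t = x"
      by (rule to_circle_representative)
    have "(\<Sum>i\<in>A. deriv_left (g i) x) \<noteq> (\<Sum>i\<in>A. deriv_right (g i) x)"
      using x deriv_right_eq[OF h r, of t] deriv_left_eq[OF h l, of t] t by (auto simp: break_points_def)
    then have "\<exists>i\<in>A. deriv_left (g i) x \<noteq> deriv_right (g i) x"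
      by (meson sum.cong)
    then show "x \<in> (\<Union>i\<in>A. break_points (g i))"
      by (simp add: break_points_def)
  qed
  then show "finite (break_points h)"
    by (rule finite_subset) (use A fin in auto)
qed

text \<open>On an affine germ the one-sided slopes of nearby points are the slope of the germ; in particular
break points are isolated.\<close>

lemma eventually_slopes_right:
  assumes f: "pl_lift f F"
  shows "\<forall>\<^sub>F x in at_right t. deriv_left f (to_circle x) = deriv_right f (to_circle t) \<and>
    deriv_right f (to_circle x) = deriv_right f (to_circle t)"
proof -
  define r where "r = deriv_right f (to_circle t)"
  have slope: "right_slope F t r"
    unfolding r_def by (rule pl_right_slope[OF f])
  then have "r > 0"
    by (simp add: right_slope_def)
  obtain e where e: "e > 0" "\<And>x. t \<le> x \<Longrightarrow> x < t + e \<Longrightarrow> F x = F t + r * (x - t)"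
    using right_slopeE[OF slope] by blast
  have "deriv_left f (to_circle x) = r \<and> deriv_right f (to_circle x) = r" if x: "t < x" "x < t + e" for x
  proof
    have "left_slope F x r"
    proof (rule left_slopeI[of _ "x - t"])
      fix y assume "y < x" "x - (x - t) < y"
      then show "F y = F x + r * (y - x)"
        using e(2)[of x] e(2)[of y] x by (simp add: algebra_simps)
    qed (use \<open>r > 0\<close> x in auto)
    then show "deriv_left f (to_circle x) = r"
      by (rule deriv_left_eq[OF pl_lift_is_lift[OF f]])
    have "right_slope F x r"
    proof (rule right_slopeI[of _ "t + e - x"])
      fix y assume "x < y" "y < x + (t + e - x)"
      then show "F y = F x + r * (y - x)"
        using e(2)[of x] e(2)[of y] x by (simp add: algebra_simps)
    qed (use \<open>r > 0\<close> x in auto)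
    then show "deriv_right f (to_circle x) = r"
      by (rule deriv_right_eq[OF pl_lift_is_lift[OF f]])
  qed
  then show ?thesis
    unfolding eventually_at_right_field r_def[symmetric] using \<open>e > 0\<close>
    by (intro exI[of _ "t + e"]) auto
qed

lemma eventually_slopes_left:
  assumes f: "pl_lift f F"
  shows "\<forall>\<^sub>F x in at_left t. deriv_left f (to_circle x) = deriv_left f (to_circle t) \<and>
    deriv_right f (to_circle x) = deriv_left f (to_circle t)"
proof -
  define r where "r = deriv_left f (to_circle t)"
  have slope: "left_slope F t r"
    unfolding r_def by (rule pl_left_slope[OF f])
  then have "r > 0"
    by (simp add: left_slope_def)
  obtain e where e: "e > 0" "\<And>x. x \<le> t \<Longrightarrow> t - e < x \<Longrightarrow> F x = F t + r * (x - t)"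
    using left_slopeE[OF slope] by blast
  have "deriv_left f (to_circle x) = r \<and> deriv_right f (to_circle x) = r" if x: "x < t" "t - e < x" for x
  proof
    have "left_slope F x r"
    proof (rule left_slopeI[of _ "x - (t - e)"])
      fix y assume "y < x" "x - (x - (t - e)) < y"
      then show "F y = F x + r * (y - x)"
        using e(2)[of x] e(2)[of y] x by (simp add: algebra_simps)
    qed (use \<open>r > 0\<close> x in auto)
    then show "deriv_left f (to_circle x) = r"
      by (rule deriv_left_eq[OF pl_lift_is_lift[OF f]])
    have "right_slope F x r"
    proof (rule right_slopeI[of _ "t - x"])
      fix y assume "x < y" "y < x + (t - x)"
      then show "F y = F x + r * (y - x)"
        using e(2)[of x] e(2)[of y] x by (simp add: algebra_simps)
    qed (use \<open>r > 0\<close> x in auto)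
    then show "deriv_right f (to_circle x) = r"
      by (rule deriv_right_eq[OF pl_lift_is_lift[OF f]])
  qed
  then show ?thesis
    unfolding eventually_at_left_field r_def[symmetric] using \<open>e > 0\<close>
    by (intro exI[of _ "t - e"]) auto
qed

text \<open>Where nothing breaks the slope is locally constant, hence constant on a connected set, and then so is
the difference to the linear function with that slope.\<close>

lemma affine_without_break_points:
  assumes f: "pl_lift f F" and A: "open A" "connected A"
    and no: "\<And>t. t \<in> A \<Longrightarrow> to_circle t \<notin> break_points f"
  shows "is_affine_on A F"
proof (cases "A = {}")
  case False
  then obtain a where a: "a \<in> A"
    by blast
  define s where "s t = deriv_left f (to_circle t)" for t
  have s_right: "deriv_right f (to_circle t) = s t" if "t \<in> A" for t
    using no[OF that] by (simp add: break_points_def s_def)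
  have s_const: "s t = s a" if "t \<in> A" for t
  proof (rule connected_local_const[where f = s and A = A])
    show "\<forall>u\<in>A. \<forall>\<^sub>F v in at u within A. s u = s v"
    proof
      fix u assume "u \<in> A"
      have "\<forall>\<^sub>F v in at_left u. s u = s v"
        using eventually_slopes_left[OF f, of u] by eventually_elim (simp add: s_def)
      moreover have "\<forall>\<^sub>F v in at_right u. s u = s v"
        using eventually_slopes_right[OF f, of u] unfolding s_right[OF \<open>u \<in> A\<close>]
        by eventually_elim (simp add: s_def)
      ultimately have "\<forall>\<^sub>F v in at u. s u = s v"
        by (simp add: eventually_at_split)
      then show "\<forall>\<^sub>F v in at u within A. s u = s v"
        by (rule filter_leD[OF at_le, rotated]) simp
    qed
  qed (use A a that in auto)
  have "F t - s a * t = F a - s a * a" if "t \<in> A" for t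
  proof (rule connected_local_const[where f = "\<lambda>t. F t - s a * t" and A = A])
    show "\<forall>u\<in>A. \<forall>\<^sub>F v in at u within A. F u - s a * u = F v - s a * v"
    proof
      fix u assume u: "u \<in> A"
      have "\<forall>\<^sub>F v in at_left u. F u - s a * u = F v - s a * v"
        using pl_left_slope[OF f, of u] s_const[OF u]
        by (auto simp: left_slope_def s_def algebra_simps elim!: eventually_mono)
      moreover have "\<forall>\<^sub>F v in at_right u. F u - s a * u = F v - s a * v"
        using pl_right_slope[OF f, of u] s_right[OF u] s_const[OF u]
        by (auto simp: right_slope_def algebra_simps elim!: eventually_mono)
      ultimately have "\<forall>\<^sub>F v in at u. F u - s a * u = F v - s a * v"
        by (simp add: eventually_at_split)
      then show "\<forall>\<^sub>F v in at u within A. F u - s a * u = F v - s a * v"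
        by (rule filter_leD[OF at_le, rotated]) simp
    qed
  qed (use A a that in auto)
  then show ?thesis
    unfolding is_affine_on_def by (intro exI[of _ "s a"] exI[of _ "F a - s a * a"]) (simp add: algebra_simps)
qed (auto simp: is_affine_on_def)

text \<open>Dividing the left slope at \<open>t\<close> by the jumps met between \<open>u\<close> and \<open>t\<close> gives a locally constant
  function of \<open>t\<close>: at a break point the slope and the product change by the same factor.\<close>

lemma deriv_left_eq_deriv_right_times_jumps:
  assumes f: "pl_lift f F" and fin: "finite (break_points f)" and uv: "u < v" "v \<le> u + 1"
  shows "deriv_left f (to_circle v)
    = deriv_right f (to_circle u) * (\<Prod>y\<in>break_points f \<inter> to_circle ` {u<..<v}. jump f y)"
proof -
  define E where "E = {t \<in> {u<..<v}. to_circle t \<in> break_points f}"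
  have inj: "inj_on to_circle E"
    by (rule inj_on_subset[OF inj_on_to_circle[OF uv(2)]]) (auto simp: E_def)
  have im: "to_circle ` E = break_points f \<inter> to_circle ` {u<..<v}"
    by (auto simp: E_def)
  have finE: "finite E"
    using fin inj im by (metis finite_Int finite_imageD)
  define J where "J t = jump f (to_circle t)" for t
  have Jpos: "J t > 0" for t
    unfolding J_def by (rule jump_pos[OF f])
  have J1: "J t = 1" if "t \<in> {u<..<v}" "t \<notin> E" for t
    using that jump_eq_1_iff[OF f, of "to_circle t"] by (simp add: J_def E_def)
  define P where "P t = (\<Prod>s\<in>E \<inter> {..<t}. J s)" for t
  have Ppos: "P t > 0" for t
    unfolding P_def by (intro prod_pos) (simp add: Jpos)
  define \<phi> where "\<phi> t = deriv_left f (to_circle t) / P t" for t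
  \<comment> \<open>Near \<open>t\<close> the finite set \<open>E\<close> has no point other than possibly \<open>t\<close>.\<close>
  have gap: "\<forall>\<^sub>F s in at t. \<forall>z\<in>E. z \<noteq> t \<longrightarrow> (z < s \<longleftrightarrow> z < t)" for t
  proof (intro eventually_ball_finite[OF finE] ballI)
    fix z
    show "\<forall>\<^sub>F s in at t. z \<noteq> t \<longrightarrow> (z < s \<longleftrightarrow> z < t)"
    proof (cases "z < t")
      case True
      then show ?thesis
        using order_tendstoD(1)[OF tendsto_ident_at True, of UNIV] by (auto elim!: eventually_mono)
    next
      case False
      show ?thesis
      proof (cases "z = t")
        case neq: False
        with False have "t < z"
          by simp
        then show ?thesis
          using order_tendstoD(2)[OF tendsto_ident_at \<open>t < z\<close>, of UNIV] by (auto elim!: eventually_mono)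
      qed simp
    qed
  qed
  have P_left: "\<forall>\<^sub>F s in at_left t. P s = P t" for t
  proof -
    have "\<forall>\<^sub>F s in at_left t. \<forall>z\<in>E. z \<noteq> t \<longrightarrow> (z < s \<longleftrightarrow> z < t)"
      using gap[of t] unfolding eventually_at_split by simp
    moreover have "\<forall>\<^sub>F s in at_left t. s < t"
      by (simp add: eventually_at_filter)
    ultimately show ?thesis
    proof eventually_elim
      case (elim s)
      then have "E \<inter> {..<s} = E \<inter> {..<t}"
        by auto
      then show ?case
        by (simp add: P_def)
    qed
  qed
  have P_right: "\<forall>\<^sub>F s in at_right t. P s = (if t \<in> E then J t else 1) * P t" for t
  proof -
    have "\<forall>\<^sub>F s in at_right t. \<forall>z\<in>E. z \<noteq> t \<longrightarrow> (z < s \<longleftrightarrow> z < t)"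
      using gap[of t] unfolding eventually_at_split by simp
    moreover have "\<forall>\<^sub>F s in at_right t. t < s"
      by (simp add: eventually_at_filter)
    ultimately show ?thesis
    proof eventually_elim
      case (elim s)
      then have "E \<inter> {..<s} = (if t \<in> E then insert t (E \<inter> {..<t}) else E \<inter> {..<t})"
        by auto
      then show ?case
        using finE by (simp add: P_def)
    qed
  qed
  have \<phi>_left: "\<forall>\<^sub>F s in at_left t. \<phi> s = \<phi> t" for t
    using P_left[of t] eventually_slopes_left[OF f, of t] by eventually_elim (simp add: \<phi>_def)
  have \<phi>_right: "\<forall>\<^sub>F s in at_right t. \<phi> s = \<phi> t" if "t \<in> {u<..<v}" for t
    using P_right[of t] eventually_slopes_right[OF f, of t]
  proof eventually_elim
    case (elim s)
    have "deriv_right f (to_circle t) = J t * deriv_left f (to_circle t)"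
      using pl_deriv_pos(2)[OF f, of "to_circle t"] by (simp add: J_def jump_def)
    moreover have "P s = J t * P t"
      using elim J1[OF that] by simp
    ultimately show ?case
      using elim(2) Jpos[of t] by (simp add: \<phi>_def)
  qed
  have const: "\<phi> s = \<phi> t" if "s \<in> {u<..<v}" "t \<in> {u<..<v}" for s t
  proof (rule connected_local_const[where f = \<phi> and A = "{u<..<v}"])
    show "\<forall>t\<in>{u<..<v}. \<forall>\<^sub>F s in at t within {u<..<v}. \<phi> t = \<phi> s"
    proof
      fix t assume "t \<in> {u<..<v}"
      then have "\<forall>\<^sub>F s in at t. \<phi> t = \<phi> s"
        using \<phi>_left[of t] \<phi>_right[of t] by (simp add: eventually_at_split eq_commute)
      then show "\<forall>\<^sub>F s in at t within {u<..<v}. \<phi> t = \<phi> s"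
        by (rule filter_leD[OF at_le, rotated]) simp
    qed
  qed (use that in auto)
  have "\<forall>\<^sub>F s in at_right u. s \<in> {u<..<v}"
    by (rule eventually_at_rightI[OF _ uv(1)])
  then have "\<forall>\<^sub>F s in at_right u. s \<in> {u<..<v} \<and> \<phi> s = deriv_right f (to_circle u)"
    using P_right[of u] eventually_slopes_right[OF f, of u]
  proof eventually_elim
    case (elim s)
    have "E \<inter> {..<u} = {}" "u \<notin> E"
      by (auto simp: E_def)
    with elim show ?case
      by (simp add: \<phi>_def P_def)
  qed
  then obtain s where s: "s \<in> {u<..<v}" "\<phi> s = deriv_right f (to_circle u)"
    using eventually_happens'[of "at_right u"] by (metis (mono_tags, lifting) trivial_limit_at_right_real)
  have "\<forall>\<^sub>F t in at_left v. t \<in> {u<..<v}"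
    by (rule eventually_at_leftI[OF _ uv(1)])
  then have "\<forall>\<^sub>F t in at_left v. t \<in> {u<..<v} \<and> \<phi> t = \<phi> v"
    using \<phi>_left[of v] by eventually_elim simp
  then obtain t where t: "t \<in> {u<..<v}" "\<phi> t = \<phi> v"
    using eventually_happens'[of "at_left v"] by (metis (mono_tags, lifting) trivial_limit_at_left_real)
  have "\<phi> v = deriv_right f (to_circle u)"
    using const[OF s(1) t(1)] s t by simp
  then have "deriv_left f (to_circle v) = deriv_right f (to_circle u) * P v"
    using Ppos[of v] by (simp add: \<phi>_def field_simps)
  moreover have "P v = (\<Prod>y\<in>break_points f \<inter> to_circle ` {u<..<v}. jump f y)"
  proof -
    have "E \<inter> {..<v} = E"
      by (auto simp: E_def)
    then show ?thesis
      unfolding P_def im[symmetric] prod.reindex[OF inj] by (simp add: J_def comp_def)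
  qed
  ultimately show ?thesis
    by simp
qed

section \<open>The local form of piecewise linearity and enumerated break points\<close>

text \<open>By continuity the affine formula extends to the closed interval, which gives a slope at each
  end as well.\<close>

lemma slopes_of_affine_piece:
  assumes F: "is_lift f F" and "\<alpha> < \<beta>" and aff: "is_affine_on {\<alpha><..<\<beta>} F"
  obtains a where "\<And>t. \<alpha> \<le> t \<Longrightarrow> t < \<beta> \<Longrightarrow> right_slope F t a" "\<And>t. \<alpha> < t \<Longrightarrow> t \<le> \<beta> \<Longrightarrow> left_slope F t a"
proof -
  obtain a c where ac: "\<And>x. x \<in> {\<alpha><..<\<beta>} \<Longrightarrow> F x = a * x + c"
    using aff unfolding is_affine_on_def by blast
  have eq: "F x = a * x + c" if "x \<in> {\<alpha>..\<beta>}" for x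
  proof -
    have cl: "closure {\<alpha><..<\<beta>} = {\<alpha>..\<beta>}"
      using \<open>\<alpha> < \<beta>\<close> by simp
    have "F x - a * x = c"
    proof (rule continuous_constant_on_closure[where S = "{\<alpha><..<\<beta>}" and f = "\<lambda>x. F x - a * x"])
      show "continuous_on (closure {\<alpha><..<\<beta>}) (\<lambda>x. F x - a * x)"
        by (intro continuous_intros continuous_on_subset[OF is_liftD(1)[OF F]]) simp
    qed (use that ac cl in auto)
    then show ?thesis
      by simp
  qed
  have "F \<alpha> < F \<beta>"
    using lift_less_iff[OF F] \<open>\<alpha> < \<beta>\<close> by blast
  then have "0 < a * (\<beta> - \<alpha>)"
    using eq[of \<alpha>] eq[of \<beta>] \<open>\<alpha> < \<beta>\<close> by (simp add: algebra_simps)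
  then have "a > 0"
    using \<open>\<alpha> < \<beta>\<close> by (simp add: zero_less_mult_iff)
  show thesis
  proof
    show "right_slope F t a" if "\<alpha> \<le> t" "t < \<beta>" for t
      by (rule right_slopeI[of _ "\<beta> - t"]) (use that \<open>a > 0\<close> eq in \<open>auto simp: algebra_simps\<close>)
    show "left_slope F t a" if "\<alpha> < t" "t \<le> \<beta>" for t
      by (rule left_slopeI[of _ "t - \<alpha>"]) (use that \<open>a > 0\<close> eq in \<open>auto simp: algebra_simps\<close>)
  qed
qed

text \<open>The first mark beyond \<open>u\<close> and its predecessor enclose \<open>u\<close>. The two versions differ in the side on
which \<open>u\<close> may coincide with a mark: the first serves right slopes, the second left slopes.\<close>

lemma between_marks:
  fixes c :: "nat \<Rightarrow> real"
  assumes "c 1 \<le> u" "u < c (Suc n)"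
  obtains i where "i \<in> {1..n}" "c i \<le> u" "u < c (Suc i)"
proof -
  define i where "i = (LEAST i. u < c (Suc i))"
  have i: "u < c (Suc i)" "i \<le> n"
    unfolding i_def using assms(2) by (rule LeastI, rule Least_le)
  have "i \<noteq> 0"
    using i(1) assms(1) by (cases i) auto
  then have "\<not> u < c (Suc (i - 1))"
    using not_less_Least[of "i - 1" "\<lambda>i. u < c (Suc i)"] by (simp flip: i_def)
  with \<open>i \<noteq> 0\<close> i show thesis
    by (intro that[of i]) auto
qed

lemma between_marks':
  fixes c :: "nat \<Rightarrow> real"
  assumes "c 1 < u" "u \<le> c (Suc n)"
  obtains i where "i \<in> {1..n}" "c i < u" "u \<le> c (Suc i)"
proof -
  define i where "i = (LEAST i. u \<le> c (Suc i))"
  have i: "u \<le> c (Suc i)" "i \<le> n"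
    unfolding i_def using assms(2) by (rule LeastI, rule Least_le)
  have "i \<noteq> 0"
    using i(1) assms(1) by (cases i) auto
  then have "\<not> u \<le> c (Suc (i - 1))"
    using not_less_Least[of "i - 1" "\<lambda>i. u \<le> c (Suc i)"] by (simp flip: i_def)
  with \<open>i \<noteq> 0\<close> i show thesis
    by (intro that[of i]) auto
qed

lemma pl_lift_change:
  assumes F: "pl_lift f F" and G: "is_lift f G"
  shows "pl_lift f G"
proof -
  obtain k where "\<And>x. G x = F x + of_int k"
    using lift_unique[OF pl_lift_is_lift[OF F] G] by blast
  then have "left_slope G t s \<longleftrightarrow> left_slope F t s" "right_slope G t s \<longleftrightarrow> right_slope F t s" for t s
    by (simp_all add: left_slope_def right_slope_def algebra_simps)
  then show ?thesis
    using F G by (simp add: pl_lift_def)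
qed

text \<open>The break points together with \<open>b 1 + 1\<close> cut a full period into \<open>n\<close> affine pieces. Every one-sided
derivative is the slope of one of the pieces, which bounds derivatives, and points inside a piece do
not break.\<close>

lemma pwl_with_breaksD:
  assumes pwl: "pwl_with_breaks f n b" and "n \<ge> 1"
  obtains F M where "pl_lift f F" "break_points f = (\<lambda>i. to_circle (b i)) ` {1..n}"
    "inj_on (\<lambda>i. to_circle (b i)) {1..n}"
    "\<And>x. deriv_right f x \<le> M" "\<And>x. deriv_left f x \<le> M"
proof -
  obtain F where F: "is_lift f F"
    and aff: "\<And>i. i \<in> {1..<n} \<Longrightarrow> is_affine_on {b i<..<b (i + 1)} F" "is_affine_on {b n<..<b 1 + 1} F"
    using pwl \<open>n \<ge> 1\<close> unfolding pwl_with_breaks_def by (auto split: if_splits)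
  have b: "\<And>i. i \<in> {1..n} \<Longrightarrow> 0 \<le> b i \<and> b i < 1" "strict_mono_on {1..n} b"
    "\<And>i. i \<in> {1..n} \<Longrightarrow> to_circle (b i) \<in> break_points f"
    using pwl unfolding pwl_with_breaks_def by auto
  define c where "c i = (if i \<le> n then b i else b 1 + 1)" for i
  have c_less: "c i < c (Suc i)" if "i \<in> {1..n}" for i
    using that b(1)[of i] b(1)[of 1] \<open>n \<ge> 1\<close> strict_mono_onD[OF b(2), of i "Suc i"]
    by (auto simp: c_def)
  have c_aff: "is_affine_on {c i<..<c (Suc i)} F" if "i \<in> {1..n}" for i
    using that aff(1)[of i] aff(2) by (cases "i = n") (auto simp: c_def)
  have "\<exists>a. (\<forall>t. c i \<le> t \<longrightarrow> t < c (Suc i) \<longrightarrow> right_slope F t a) \<and>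
      (\<forall>t. c i < t \<longrightarrow> t \<le> c (Suc i) \<longrightarrow> left_slope F t a)" if "i \<in> {1..n}" for i
    using slopes_of_affine_piece[OF F c_less[OF that] c_aff[OF that]] by metis
  then obtain a where a: "\<And>i t. i \<in> {1..n} \<Longrightarrow> c i \<le> t \<Longrightarrow> t < c (Suc i) \<Longrightarrow> right_slope F t (a i)"
    "\<And>i t. i \<in> {1..n} \<Longrightarrow> c i < t \<Longrightarrow> t \<le> c (Suc i) \<Longrightarrow> left_slope F t (a i)"
    by metis
  have c_ends: "c 1 = b 1" "c (Suc n) = b 1 + 1"
    using \<open>n \<ge> 1\<close> by (auto simp: c_def)
  have right: "\<exists>i u. i \<in> {1..n} \<and> c i \<le> u \<and> u < c (Suc i) \<and> to_circle u = x" for x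
  proof -
    obtain u where u: "b 1 \<le> u" "u < b 1 + 1" "to_circle u = x"
      by (rule to_circle_representative)
    with between_marks[of c u n] c_ends show ?thesis
      by metis
  qed
  have left: "\<exists>i u. i \<in> {1..n} \<and> c i < u \<and> u \<le> c (Suc i) \<and> to_circle u = x" for x
  proof -
    obtain u where u: "b 1 \<le> u" "u < b 1 + 1" "to_circle u = x"
      by (rule to_circle_representative)
    show ?thesis
    proof (cases "u = b 1")
      case True
      have "to_circle (u + of_int 1) = x"
        by (simp only: to_circle_add_of_int u)
      then show ?thesis
        using between_marks'[of c "u + 1" n] c_ends True by (metis less_add_one of_int_1 order_refl)
    next
      case False
      then show ?thesis
        using between_marks'[of c u n] c_ends u by (metis less_eq_real_def)
    qed
  qed
  have dr: "deriv_right f x \<in> a ` {1..n}" for x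
    using right[of x] a(1) deriv_right_eq[OF F] by blast
  have dl: "deriv_left f x \<in> a ` {1..n}" for x
    using left[of x] a(2) deriv_left_eq[OF F] by blast
  have pl: "pl_lift f F"
    unfolding pl_lift_def
  proof (intro conjI allI)
    fix t
    obtain i u where iu: "i \<in> {1..n}" "c i \<le> u" "u < c (Suc i)" "to_circle t = to_circle u"
      using right by metis
    obtain j v where jv: "j \<in> {1..n}" "c j < v" "v \<le> c (Suc j)" "to_circle t = to_circle v"
      using left by metis
    obtain k where k: "t = u + of_int k"
      using to_circle_eqE[OF iu(4)] .
    obtain l where l: "t = v + of_int l"
      using to_circle_eqE[OF jv(4)] .
    have "right_slope F t (a i)"
      unfolding k by (rule right_slope_translate[OF F a(1)[OF iu(1-3)]])
    moreover have "left_slope F t (a j)"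
      unfolding l by (rule left_slope_translate[OF F a(2)[OF jv(1-3)]])
    ultimately show "\<exists>l r. left_slope F t l \<and> right_slope F t r"
      by blast
  qed (rule F)
  have "break_points f \<subseteq> (\<lambda>i. to_circle (b i)) ` {1..n}"
  proof
    fix x assume x: "x \<in> break_points f"
    obtain i u where iu: "i \<in> {1..n}" "c i \<le> u" "u < c (Suc i)" "to_circle u = x"
      using right by metis
    have "u = c i"
    proof (rule ccontr)
      assume "u \<noteq> c i"
      then have "left_slope F u (a i)" "right_slope F u (a i)"
        using iu a by auto
      then have "deriv_left f x = deriv_right f x"
        using deriv_left_eq[OF F] deriv_right_eq[OF F] iu(4) by metis
      with x show False
        by (simp add: break_points_def)
    qed
    with iu have "x = to_circle (b i)"
      by (simp add: c_def)
    with iu(1) show "x \<in> (\<lambda>i. to_circle (b i)) ` {1..n}"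
      by blast
  qed
  then have breaks: "break_points f = (\<lambda>i. to_circle (b i)) ` {1..n}"
    using b(3) by auto
  have inj: "inj_on (\<lambda>i. to_circle (b i)) {1..n}"
  proof (rule inj_onI)
    fix i j assume ij: "i \<in> {1..n}" "j \<in> {1..n}" and "to_circle (b i) = to_circle (b j)"
    then have "b i - b j \<in> \<int>" "\<bar>b i - b j\<bar> < 1"
      using b(1)[OF ij(1)] b(1)[OF ij(2)] by (auto simp: to_circle_eq_iff)
    then have "b i = b j"
      using Ints_abs_less_1 by fastforce
    then show "i = j"
      using strict_mono_on_imp_inj_on[OF b(2)] ij by (auto dest: inj_onD)
  qed
  show thesis
    by (rule that[OF pl breaks inj, of "Max (a ` {1..n})"]) (use dr dl in \<open>auto intro: Max_ge\<close>)
qed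

text \<open>The required enumeration lists the break points in \<open>[0, 1)\<close> in increasing order; nothing breaks between
consecutive ones, nor between the last one and the first one a period later.\<close>

lemma pwl_of_pl_lift:
  assumes h: "pl_lift h H" and homeo: "orientation_preserving_homeo h" and fin: "finite (break_points h)"
  shows "pwl h"
proof -
  define T where "T = {t. 0 \<le> t \<and> t < 1 \<and> to_circle t \<in> break_points h}"
  have "inj_on to_circle T"
  proof (rule inj_onI)
    fix x y assume "x \<in> T" "y \<in> T" "to_circle x = to_circle y"
    then have "x - y \<in> \<int>" "\<bar>x - y\<bar> < 1"
      by (auto simp: to_circle_eq_iff T_def)
    then show "x = y"
      using Ints_abs_less_1 by fastforce
  qed
  moreover have "to_circle ` T \<subseteq> break_points h"
    by (auto simp: T_def)
  ultimately have "finite T"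
    using fin by (metis finite_imageD finite_subset)
  define n where "n = card T"
  define b where "b i = sorted_list_of_set T ! (i - 1)" for i
  have len: "length (sorted_list_of_set T) = n"
    by (simp add: n_def)
  have b_in: "b i \<in> T" if "i \<in> {1..n}" for i
  proof -
    have "b i \<in> set (sorted_list_of_set T)"
      unfolding b_def using that len by (intro nth_mem) auto
    then show ?thesis
      using \<open>finite T\<close> by simp
  qed
  have b_onto: "\<exists>i\<in>{1..n}. t = b i" if "t \<in> T" for t
  proof -
    have "t \<in> set (sorted_list_of_set T)"
      using that \<open>finite T\<close> by simp
    then obtain j where "j < n" "sorted_list_of_set T ! j = t"
      unfolding in_set_conv_nth len by blast
    then show ?thesis
      by (intro bexI[of _ "Suc j"]) (auto simp: b_def)
  qed
  have b_less: "b i < b j" if "i \<in> {1..n}" "j \<in> {1..n}" "i < j" for i j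
    unfolding b_def using that len
    by (intro sorted_wrt_nth_less[OF strict_sorted_list_of_set]) auto
  have b_le: "b i \<le> b j" if "i \<in> {1..n}" "j \<in> {1..n}" "i \<le> j" for i j
    using b_less[OF that(1,2)] that(3) by (cases "i = j") auto
  have aff: "is_affine_on A H" if "open A" "connected A" "\<And>t. t \<in> A \<Longrightarrow> to_circle t \<notin> break_points h" for A
    by (rule affine_without_break_points[OF h that])
  have "is_affine_on {b i<..<b (i + 1)} H" if i: "i \<in> {1..<n}" for i
  proof (rule aff)
    fix t assume t: "t \<in> {b i<..<b (i + 1)}"
    show "to_circle t \<notin> break_points h"
    proof
      assume "to_circle t \<in> break_points h"
      moreover have "0 \<le> b i" "b (i + 1) < 1"
        using b_in[of i] b_in[of "i + 1"] i by (auto simp: T_def)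
      ultimately have "t \<in> T"
        using t by (auto simp: T_def)
      then obtain j where j: "j \<in> {1..n}" "t = b j"
        using b_onto by blast
      show False
        using b_le[of j i] b_le[of "i + 1" j] i j t by (cases "j \<le> i") auto
    qed
  qed auto
  moreover have "is_affine_on {b n<..<b 1 + 1} H" if "n \<noteq> 0"
  proof (rule aff)
    fix t assume t: "t \<in> {b n<..<b 1 + 1}"
    have ends: "0 \<le> b n" "b 1 < 1"
      using b_in[of n] b_in[of 1] that by (auto simp: T_def)
    show "to_circle t \<notin> break_points h"
    proof
      assume br: "to_circle t \<in> break_points h"
      show False
      proof (cases "t < 1")
        case True
        then have "t \<in> T"
          using t ends br by (auto simp: T_def)
        then obtain j where "j \<in> {1..n}" "t = b j"
          using b_onto by blast
        then show False
          using b_le[of j n] t by auto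
      next
        case False
        have "to_circle (t + of_int (- 1)) \<in> break_points h"
          by (simp only: to_circle_add_of_int br)
        then have "t - 1 \<in> T"
          using t ends False by (auto simp: T_def)
        then obtain j where "j \<in> {1..n}" "t - 1 = b j"
          using b_onto by blast
        then show False
          using b_le[of 1 j] t by auto
      qed
    qed
  qed auto
  moreover have "is_affine_on UNIV H" if "n = 0"
  proof (rule aff)
    fix t :: real
    have "T = {}"
      using that \<open>finite T\<close> by (simp add: n_def)
    obtain s where "0 \<le> s" "s < 0 + 1" "to_circle s = to_circle t"
      by (rule to_circle_representative)
    with \<open>T = {}\<close> show "to_circle t \<notin> break_points h"
      by (auto simp: T_def)
  qed auto
  ultimately have "pwl_with_breaks h n b"
    unfolding pwl_with_breaks_def using homeo b_in b_less pl_lift_is_lift[OF h]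
    by (auto simp: T_def intro!: strict_mono_onI exI[of _ H])
  then show ?thesis
    unfolding pwl_def by blast
qed

section \<open>Orbits\<close>

lemma inj_funpow:
  fixes f :: "'a \<Rightarrow> 'a"
  assumes "bij f"
  shows "(f ^^ k) x = (f ^^ k) y \<longleftrightarrow> x = y"
  using inj_eq[OF bij_is_inj[OF assms]] by (induction k) simp_all

lemma full_orbit_iff:
  assumes "bij f"
  shows "z \<in> full_orbit f y \<longleftrightarrow> (\<exists>k. (f ^^ k) y = z \<or> (f ^^ k) z = y)"
proof -
  have "(inv f ^^ k) y = z \<longleftrightarrow> (f ^^ k) z = y" for k
    using bij_inv_eq_iff[OF bij_fn[OF assms, of k]] inv_fn[OF assms, of k] by metis
  moreover have "z \<in> full_orbit f y \<longleftrightarrow> (\<exists>k. (f ^^ k) y = z) \<or> (\<exists>k. (inv f ^^ k) y = z)"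
    unfolding full_orbit_def by blast
  ultimately show ?thesis
    by (simp add: ex_disj_distrib)
qed

lemma full_orbit_step:
  assumes "bij f"
  shows "full_orbit f (f y) = full_orbit f y"
proof (rule set_eqI)
  fix w
  have "(\<exists>k. (f ^^ k) (f y) = w \<or> (f ^^ k) w = f y) \<longleftrightarrow> (\<exists>k. (f ^^ k) y = w \<or> (f ^^ k) w = y)"
  proof
    assume "\<exists>k. (f ^^ k) (f y) = w \<or> (f ^^ k) w = f y"
    then obtain k where k: "(f ^^ k) (f y) = w \<or> (f ^^ k) w = f y"
      by blast
    show "\<exists>k. (f ^^ k) y = w \<or> (f ^^ k) w = y"
    proof (cases "(f ^^ k) (f y) = w")
      case True
      then have "(f ^^ Suc k) y = w"
        by (simp add: funpow_swap1)
      then show ?thesis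
        by blast
    next
      case False
      then have w: "(f ^^ k) w = f y"
        using k by blast
      with False obtain j where "k = Suc j"
        by (cases k) auto
      then have "(f ^^ j) w = y"
        using w bij_is_inj[OF assms] by (auto dest: injD)
      then show ?thesis
        by blast
    qed
  next
    assume "\<exists>k. (f ^^ k) y = w \<or> (f ^^ k) w = y"
    then obtain k where k: "(f ^^ k) y = w \<or> (f ^^ k) w = y"
      by blast
    show "\<exists>k. (f ^^ k) (f y) = w \<or> (f ^^ k) w = f y"
    proof (cases "(f ^^ k) w = y")
      case True
      then have "(f ^^ Suc k) w = f y"
        by simp
      then show ?thesis
        by blast
    next
      case False
      then have w: "(f ^^ k) y = w"
        using k by blast
      with False obtain j where "k = Suc j"
        by (cases k) auto
      then have "(f ^^ j) (f y) = w"
        using w by (simp add: funpow_swap1)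
      then show ?thesis
        by blast
    qed
  qed
  then show "w \<in> full_orbit f (f y) \<longleftrightarrow> w \<in> full_orbit f y"
    by (simp add: full_orbit_iff[OF assms])
qed

lemma orbit_invariant:
  assumes "bij f" and z: "z \<in> full_orbit f y" and m: "\<And>x. m (f x) = m x"
  shows "m z = m y"
proof -
  have "m ((f ^^ k) x) = m x" for k x
    by (induction k) (simp_all add: m)
  with z show ?thesis
    unfolding full_orbit_iff[OF assms(1)] by metis
qed

lemma full_orbit_eq_iff:
  assumes "bij f"
  shows "full_orbit f z = full_orbit f y \<longleftrightarrow> z \<in> full_orbit f y"
proof
  assume "full_orbit f z = full_orbit f y"
  moreover have "z \<in> full_orbit f z"
    by (auto simp: full_orbit_def image_iff intro!: exI[of _ 0])
  ultimately show "z \<in> full_orbit f y"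
    by simp
next
  assume "z \<in> full_orbit f y"
  then show "full_orbit f z = full_orbit f y"
    by (rule orbit_invariant[OF assms]) (rule full_orbit_step[OF assms])
qed

section \<open>Gaps between periodic points\<close>

lemma lift_image_Ioo:
  assumes F: "is_lift f F"
  shows "f ` to_circle ` {a<..<b} = to_circle ` {F a<..<F b}"
proof -
  have "F ` {a<..<b} = {F a<..<F b}"
  proof
    show "{F a<..<F b} \<subseteq> F ` {a<..<b}"
    proof
      fix y assume y: "y \<in> {F a<..<F b}"
      obtain x where x: "y = F x"
        using surj_lift[OF F] by (rule surjE)
      with y have "x \<in> {a<..<b}"
        by (simp add: lift_less_iff[OF F])
      with x show "y \<in> F ` {a<..<b}"
        by blast
    qed
  qed (simp add: lift_less_iff[OF F] image_subset_iff)
  then show ?thesis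
    by (simp add: image_image is_liftD(4)[OF F] flip: image_image[of to_circle F])
qed

text \<open>The ends of the gap are the nearest fixed points on either side of \<open>x\<close>. The set of fixed points is
closed and invariant under integer translations, so they exist and are at most one period apart.\<close>

lemma non_fixed_gap:
  assumes G: "is_lift g G" and c: "G c = c" and x: "G x \<noteq> x"
  obtains a b where "a < x" "x < b" "b \<le> a + 1" "G a = a" "G b = b"
    "(\<forall>t\<in>{a<..<b}. G t > t) \<or> (\<forall>t\<in>{a<..<b}. G t < t)"
proof -
  define S where "S = {y. G y = y}"
  have closed: "closed S"
    unfolding S_def by (intro closed_Collect_eq is_liftD(1)[OF G] continuous_on_id)
  have S_int: "y + of_int k \<in> S" if "y \<in> S" for y k
    using that by (simp add: S_def lift_add_of_int[OF G])
  have "c \<in> S"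
    using c by (simp add: S_def)
  have "c + of_int (\<lfloor>x - c\<rfloor>) \<in> S \<inter> {..x}"
    using S_int[OF \<open>c \<in> S\<close>, of "\<lfloor>x - c\<rfloor>"] by simp linarith
  then have ne1: "S \<inter> {..x} \<noteq> {}"
    by blast
  have "c + of_int (\<lceil>x - c\<rceil>) \<in> S \<inter> {x..}"
    using S_int[OF \<open>c \<in> S\<close>, of "\<lceil>x - c\<rceil>"] by simp linarith
  then have ne2: "S \<inter> {x..} \<noteq> {}"
    by blast
  define a where "a = Sup (S \<inter> {..x})"
  define b where "b = Inf (S \<inter> {x..})"
  have bdd: "bdd_above (S \<inter> {..x})" "bdd_below (S \<inter> {x..})"
    by auto
  have "a \<in> S \<inter> {..x}"
    unfolding a_def by (rule closed_contains_Sup[OF ne1 bdd(1)]) (simp add: closed closed_Int)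
  then have a: "a \<in> S" "a \<le> x"
    by auto
  have "b \<in> S \<inter> {x..}"
    unfolding b_def by (rule closed_contains_Inf[OF ne2 bdd(2)]) (simp add: closed closed_Int)
  then have b: "b \<in> S" "x \<le> b"
    by auto
  have a_max: "y \<le> a" if "y \<in> S" "y \<le> x" for y
    unfolding a_def using that by (intro cSup_upper bdd) auto
  have b_min: "b \<le> y" if "y \<in> S" "x \<le> y" for y
    unfolding b_def using that by (intro cInf_lower bdd) auto
  have "x \<notin> S"
    using x by (simp add: S_def)
  then have "a < x" "x < b"
    using a b by (metis order_le_less)+
  have "a + 1 \<in> S"
    using S_int[OF a(1), of 1] by simp
  then have "b \<le> a + 1"
    using a_max[of "a + 1"] b_min[of "a + 1"] by linarith
  have no: "t \<notin> S" if "t \<in> {a<..<b}" for t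
    using that a_max[of t] b_min[of t] by fastforce
  define d where "d t = G t - t" for t
  have conn: "connected (d ` {a<..<b})"
    unfolding d_def
    by (intro connected_continuous_image continuous_intros continuous_on_subset[OF is_liftD(1)[OF G]]) auto
  have "(\<forall>t\<in>{a<..<b}. d t > 0) \<or> (\<forall>t\<in>{a<..<b}. d t < 0)"
  proof (rule ccontr)
    assume "\<not> ?thesis"
    then obtain s t where st: "s \<in> {a<..<b}" "t \<in> {a<..<b}" "d s \<le> 0" "0 \<le> d t"
      by (meson not_less)
    then have "0 \<in> d ` {a<..<b}"
      using conn unfolding connected_iff_interval by (meson imageI)
    with no show False
      by (auto simp: d_def S_def)
  qed
  then have "(\<forall>t\<in>{a<..<b}. G t > t) \<or> (\<forall>t\<in>{a<..<b}. G t < t)"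
    by (simp add: d_def)
  then show thesis
    using that[of a b] \<open>a < x\<close> \<open>x < b\<close> \<open>b \<le> a + 1\<close> a(1) b(1) by (simp add: S_def)
qed

lemma gap_iterate:
  assumes G: "is_lift g G" and ends: "G a = a" "G b = b"
    and sign: "(\<forall>t\<in>{a<..<b}. G t > t) \<or> (\<forall>t\<in>{a<..<b}. G t < t)" and t: "t \<in> {a<..<b}"
  shows "(G ^^ k) t \<in> {a<..<b}"
    and "(\<forall>t\<in>{a<..<b}. G t > t) \<Longrightarrow> (G ^^ Suc k) t \<ge> G t"
    and "(\<forall>t\<in>{a<..<b}. G t < t) \<Longrightarrow> (G ^^ Suc k) t \<le> G t"
proof -
  have inv: "(G ^^ k) t \<in> {a<..<b}" for k
  proof (induction k)
    case (Suc k)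
    then show ?case
      using lift_less_iff[OF G, of a "(G ^^ k) t"] lift_less_iff[OF G, of "(G ^^ k) t" b] ends by simp
  qed (use t in simp)
  then show "(G ^^ k) t \<in> {a<..<b}" .
  show "(G ^^ Suc k) t \<ge> G t" if up: "\<forall>t\<in>{a<..<b}. G t > t"
  proof (induction k)
    case (Suc k)
    have "(G ^^ Suc k) t < G ((G ^^ Suc k) t)"
      using up inv by blast
    with Suc show ?case
      by simp
  qed simp
  show "(G ^^ Suc k) t \<le> G t" if down: "\<forall>t\<in>{a<..<b}. G t < t"
  proof (induction k)
    case (Suc k)
    have "(G ^^ Suc k) t > G ((G ^^ Suc k) t)"
      using down inv by blast
    with Suc show ?case
      by simp
  qed simp
qed

text \<open>A periodic point in an image of the gap could be pulled back to a periodic point in the gap itself,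
where iterates of \<open>G\<close> move every point strictly in one direction.\<close>

lemma gap_aperiodic:
  assumes f: "is_lift f F" and G: "is_lift (f ^^ Q) G" and ab: "b \<le> a + 1" "G a = a" "G b = b"
    and sign: "(\<forall>t\<in>{a<..<b}. G t > t) \<or> (\<forall>t\<in>{a<..<b}. G t < t)"
    and y: "y \<in> (f ^^ i) ` to_circle ` {a<..<b}" and "k > 0"
  shows "(f ^^ k) y \<noteq> y"
proof
  assume eq: "(f ^^ k) y = y"
  obtain t where t: "t \<in> {a<..<b}" "y = (f ^^ i) (to_circle t)"
    using y by auto
  have "(f ^^ i) ((f ^^ k) (to_circle t)) = (f ^^ i) (to_circle t)"
    using eq unfolding t(2) by (metis add.commute comp_apply funpow_add)
  then have "(f ^^ k) (to_circle t) = to_circle t"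
    by (simp add: inj_funpow[OF bij_of_lift[OF f]])
  then have "((f ^^ k) ^^ Q) (to_circle t) = to_circle t"
    by (induction Q) simp_all
  then have "((f ^^ Q) ^^ k) (to_circle t) = to_circle t"
    by (simp add: funpow_mult mult.commute)
  then have "to_circle ((G ^^ k) t) = to_circle t"
    by (simp add: is_liftD(4)[OF is_lift_funpow[OF G]])
  then have "(G ^^ k) t = t"
    using inj_on_to_circle[OF ab(1)] gap_iterate(1)[OF G ab(2,3) sign t(1)] t(1) by (auto dest: inj_onD)
  moreover obtain j where "k = Suc j"
    using \<open>k > 0\<close> gr0_implies_Suc by blast
  ultimately show False
    using gap_iterate(2,3)[OF G ab(2,3) sign t(1), of j] sign t(1) by fastforce
qed

lemma exists_gap:
  assumes G: "is_lift g G" and c: "G c = c" and "g \<noteq> id"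
  obtains a b where "a < b" "b \<le> a + 1" "G a = a" "G b = b"
    "(\<forall>t\<in>{a<..<b}. G t > t) \<or> (\<forall>t\<in>{a<..<b}. G t < t)"
proof -
  obtain x where x: "g x \<noteq> x"
    using \<open>g \<noteq> id\<close> by (metis eq_id_iff)
  obtain t where t: "to_circle t = x"
    by (rule to_circle_representative)
  then have "G t \<noteq> t"
    using x is_liftD(4)[OF G, of t] by auto
  from non_fixed_gap[OF G c this] obtain a b where ab: "a < t" "t < b" "b \<le> a + 1" "G a = a" "G b = b"
    "(\<forall>t\<in>{a<..<b}. G t > t) \<or> (\<forall>t\<in>{a<..<b}. G t < t)" .
  show thesis
    by (rule that[OF less_trans[OF ab(1,2)] ab(3-6)])
qed

text \<open>Near the end \<open>a\<close> the displacement is \<open>G t - t = (slope - 1) * (t - a)\<close>, and similarly near \<open>b\<close>. As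
it has no zero in the gap, slope \<open>1\<close> is excluded and its sign decides the rest.\<close>

lemma slopes_at_gap_ends:
  assumes g: "pl_lift g G" and "a < b" and ends: "G a = a" "G b = b"
  shows "\<forall>t\<in>{a<..<b}. G t > t \<Longrightarrow> deriv_right g (to_circle a) > 1"
    "\<forall>t\<in>{a<..<b}. G t > t \<Longrightarrow> deriv_left g (to_circle b) < 1"
    "\<forall>t\<in>{a<..<b}. G t < t \<Longrightarrow> deriv_right g (to_circle a) < 1"
    "\<forall>t\<in>{a<..<b}. G t < t \<Longrightarrow> deriv_left g (to_circle b) > 1"
proof -
  obtain e where e: "e > 0" "\<And>x. a \<le> x \<Longrightarrow> x < a + e \<Longrightarrow> G x = G a + deriv_right g (to_circle a) * (x - a)"
    using right_slopeE[OF pl_right_slope[OF g]] by blast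
  define s where "s = a + min e (b - a) / 2"
  have s: "s \<in> {a<..<b}" "s < a + e"
    using e(1) \<open>a < b\<close> by (auto simp: s_def min_def field_simps)
  have Gs: "G s - s = (deriv_right g (to_circle a) - 1) * (s - a)"
    using e(2)[of s] s ends by (simp add: algebra_simps)
  obtain d where d: "d > 0" "\<And>x. x \<le> b \<Longrightarrow> b - d < x \<Longrightarrow> G x = G b + deriv_left g (to_circle b) * (x - b)"
    using left_slopeE[OF pl_left_slope[OF g]] by blast
  define t where "t = b - min d (b - a) / 2"
  have t: "t \<in> {a<..<b}" "b - d < t"
    using d(1) \<open>a < b\<close> by (auto simp: t_def min_def field_simps)
  have Gt: "G t - t = (1 - deriv_left g (to_circle b)) * (b - t)"
    using d(2)[of t] t ends by (simp add: algebra_simps)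
  show "deriv_right g (to_circle a) > 1" "deriv_left g (to_circle b) < 1"
    if up: "\<forall>t\<in>{a<..<b}. G t > t"
  proof -
    have "0 < (deriv_right g (to_circle a) - 1) * (s - a)"
      using up s unfolding Gs[symmetric] by auto
    then show "deriv_right g (to_circle a) > 1"
      using s by (simp add: zero_less_mult_iff)
    have "0 < (1 - deriv_left g (to_circle b)) * (b - t)"
      using up t unfolding Gt[symmetric] by auto
    then show "deriv_left g (to_circle b) < 1"
      using t by (simp add: zero_less_mult_iff)
  qed
  show "deriv_right g (to_circle a) < 1" "deriv_left g (to_circle b) > 1"
    if down: "\<forall>t\<in>{a<..<b}. G t < t"
  proof -
    have "(deriv_right g (to_circle a) - 1) * (s - a) < 0"
      using down s unfolding Gs[symmetric] by auto
    then show "deriv_right g (to_circle a) < 1"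
      using s by (simp add: mult_less_0_iff)
    have "(1 - deriv_left g (to_circle b)) * (b - t) < 0"
      using down t unfolding Gt[symmetric] by auto
    then show "deriv_left g (to_circle b) > 1"
      using t by (simp add: mult_less_0_iff)
  qed
qed

section \<open>Jumps along orbits through a gap\<close>

text \<open>Let \<open>I\<close> be the gap on the circle. By the jump formula on each of the \<open>Q\<close> intervals \<open>(f ^^ i) ` I\<close> and
the chain rule, the ratio of the slopes of \<open>f ^^ Q\<close> at \<open>b\<close> and \<open>a\<close> is the product of \<open>jump f y\<close> over
all \<open>y\<close>, with the number of visits \<open>i < Q\<close>, \<open>y \<in> (f ^^ i) ` I\<close>, as exponent. Grouped by orbits, this
product is trivial as soon as all visited orbits have trivial jump product.\<close>

lemma nontrivial_orbit_product:
  assumes f: "pl_lift f F" and fin: "finite (break_points f)"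
    and G: "is_lift (f ^^ Q) G" and ab: "a < b" "b \<le> a + 1" "G a = a" "G b = b"
    and neq: "deriv_left (f ^^ Q) (to_circle b) \<noteq> deriv_right (f ^^ Q) (to_circle a)"
  shows "\<exists>y\<in>break_points f. \<exists>i. y \<in> (f ^^ i) ` to_circle ` {a<..<b} \<and>
    (\<Prod>z\<in>break_points f \<inter> full_orbit f y. jump f z) \<noteq> 1"
proof (rule ccontr)
  assume contra: "\<not> ?thesis"
  have trivial: "(\<Prod>z\<in>break_points f \<inter> full_orbit f y. jump f z) = 1"
    if "y \<in> break_points f" "y \<in> (f ^^ i) ` to_circle ` {a<..<b}" for y i
    using that contra by blast
  define B where "B = break_points f"
  define J where "J = jump f"
  define I where "I = to_circle ` {a<..<b}"
  define visits :: "nat \<Rightarrow> circle \<Rightarrow> nat" where "visits i y = (if y \<in> (f ^^ i) ` I then 1 else 0)" for i y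
  define m where "m y = (\<Sum>i<Q. visits i y)" for y
  have bij: "bij f"
    by (rule bij_of_lift[OF pl_lift_is_lift[OF f]])
  have finB: "finite B"
    using fin by (simp add: B_def)
  have step: "deriv_left f ((f ^^ i) (to_circle b))
      = deriv_right f ((f ^^ i) (to_circle a)) * (\<Prod>y\<in>B. J y ^ visits i y)" for i
  proof -
    have Fi: "is_lift (f ^^ i) (F ^^ i)"
      by (rule is_lift_funpow[OF pl_lift_is_lift[OF f]])
    have "(F ^^ i) a < (F ^^ i) b" "(F ^^ i) b \<le> (F ^^ i) a + 1"
      using lift_less_iff[OF Fi] ab(1) strict_mono_less_eq[OF is_liftD(2)[OF Fi], of b "a + 1"] ab(2)
        is_liftD(3)[OF Fi] by auto
    from deriv_left_eq_deriv_right_times_jumps[OF f fin this]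
    have "deriv_left f ((f ^^ i) (to_circle b))
      = deriv_right f ((f ^^ i) (to_circle a)) * (\<Prod>y\<in>B \<inter> (f ^^ i) ` I. J y)"
      unfolding B_def J_def I_def lift_image_Ioo[OF Fi] is_liftD(4)[OF Fi] .
    also have "(\<Prod>y\<in>B \<inter> (f ^^ i) ` I. J y) = (\<Prod>y\<in>B. J y ^ visits i y)"
      unfolding prod.inter_restrict[OF finB] by (rule prod.cong) (auto simp: visits_def)
    finally show ?thesis .
  qed
  have "deriv_left (f ^^ Q) (to_circle b)
      = deriv_right (f ^^ Q) (to_circle a) * (\<Prod>i<Q. \<Prod>y\<in>B. J y ^ visits i y)"
    unfolding deriv_funpow[OF f] step prod.distrib ..
  also have "(\<Prod>i<Q. \<Prod>y\<in>B. J y ^ visits i y) = (\<Prod>y\<in>B. J y ^ m y)"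
    unfolding prod.swap[of _ B] m_def power_sum ..
  finally have "(\<Prod>y\<in>B. J y ^ m y) \<noteq> 1"
    using neq by auto
  \<comment> \<open>The gap is mapped onto itself by \<open>f ^^ Q\<close>, so the number of its first \<open>Q\<close> images that contain a
    point is an orbit invariant.\<close>
  have "(f ^^ Q) ` I = I"
    unfolding I_def lift_image_Ioo[OF G] ab(3,4) ..
  then have visits_Q: "visits Q y = visits 0 y" for y
    by (simp add: visits_def)
  have visits_Suc: "visits (Suc i) (f y) = visits i y" for i y
    using bij_is_inj[OF bij] by (auto simp: visits_def image_image inj_eq)
  have m_step: "m (f y) = m y" for y
  proof -
    have "m (f y) + visits Q (f y) = (\<Sum>i<Suc Q. visits i (f y))"
      by (simp add: m_def)
    also have "\<dots> = visits 0 (f y) + m y"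
      unfolding sum.lessThan_Suc_shift visits_Suc m_def ..
    finally show ?thesis
      by (simp add: visits_Q)
  qed
  have "(\<Prod>y\<in>B. J y ^ m y) = (\<Prod>U\<in>full_orbit f ` B. \<Prod>y\<in>{y\<in>B. full_orbit f y = U}. J y ^ m y)"
    by (rule prod.group[symmetric]) (use finB in auto)
  also have "\<dots> = 1"
  proof (rule prod.neutral, safe)
    fix y0 assume y0: "y0 \<in> B"
    have "(\<Prod>y\<in>{y\<in>B. full_orbit f y = full_orbit f y0}. J y ^ m y)
        = (\<Prod>y\<in>B \<inter> full_orbit f y0. J y ^ m y0)"
      by (rule prod.cong)
        (use orbit_invariant[where m = m, OF bij _ m_step] in \<open>auto simp: full_orbit_eq_iff[OF bij]\<close>)
    also have "\<dots> = (\<Prod>y\<in>B \<inter> full_orbit f y0. J y) ^ m y0"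
      by (rule prod_power_distrib[symmetric])
    also have "\<dots> = 1"
    proof (cases "m y0 = 0")
      case False
      then have "\<exists>i. y0 \<in> (f ^^ i) ` I"
        unfolding m_def visits_def by (rule contrapos_np) simp
      then obtain i where "y0 \<in> (f ^^ i) ` I"
        by blast
      then have "(\<Prod>y\<in>B \<inter> full_orbit f y0. J y) = 1"
        using y0 trivial[of y0 i] unfolding B_def J_def I_def by blast
      then show ?thesis
        by simp
    qed simp
    finally show "(\<Prod>y\<in>{y\<in>B. full_orbit f y = full_orbit f y0}. J y ^ m y) = 1" .
  qed
  finally show False
    using \<open>(\<Prod>y\<in>B. J y ^ m y) \<noteq> 1\<close> by contradiction
qed

text \<open>The break points on the orbit of \<open>y\<close> lie among finitely many consecutive orbit points. For each starting
point whose first \<open>K\<close> iterates contain this whole stretch, the jump of \<open>f ^^ K\<close> is the jump product of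
the orbit. The orbit being infinite, different starting points are different, and \<open>K\<close> can be chosen
to leave room for more than \<open>N\<close> of them.\<close>

lemma unbounded_break_points:
  assumes f: "pl_lift f F" and fin: "finite (break_points f)"
    and aper: "\<And>k. k > 0 \<Longrightarrow> (f ^^ k) y \<noteq> y"
    and prod: "(\<Prod>z\<in>break_points f \<inter> full_orbit f y. jump f z) \<noteq> 1"
  obtains K where "K \<ge> 1" "card (break_points (f ^^ K)) > N"
proof -
  define B where "B = break_points f \<inter> full_orbit f y"
  have bij: "bij f"
    by (rule bij_of_lift[OF pl_lift_is_lift[OF f]])
  have finB: "finite B"
    using fin by (simp add: B_def)
  have "\<forall>z\<in>B. \<exists>k. (f ^^ k) y = z \<or> (f ^^ k) z = y"
    by (simp add: B_def full_orbit_iff[OF bij])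
  then obtain k where k: "\<And>z. z \<in> B \<Longrightarrow> (f ^^ k z) y = z \<or> (f ^^ k z) z = y"
    by metis
  define n where "n = (\<Sum>z\<in>B. k z)"
  have k_le: "k z \<le> n" if "z \<in> B" for z
    unfolding n_def using that finB by (intro member_le_sum) auto
  have undo: "(f ^^ j) ((inv f ^^ j) x) = x" for j x
    using fn_o_inv_fn_is_id[OF bij, of j] by (metis comp_apply id_apply)
  \<comment> \<open>Each break point on the orbit is at most \<open>n\<close> steps before or after \<open>y\<close>.\<close>
  define w where "w = (inv f ^^ n) y"
  have w: "(f ^^ n) w = y"
    unfolding w_def by (rule undo)
  have B_w: "\<exists>i\<le>2 * n. (f ^^ i) w = z" if "z \<in> B" for z
    using k[OF that]
  proof
    assume "(f ^^ k z) y = z"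
    then have "(f ^^ (k z + n)) w = z"
      by (simp add: funpow_add w)
    then show ?thesis
      using k_le[OF that] by (intro exI[of _ "k z + n"]) auto
  next
    assume "(f ^^ k z) z = y"
    also have "y = (f ^^ k z) ((f ^^ (n - k z)) w)"
      using k_le[OF that] by (simp add: w flip: funpow_add[THEN fun_cong, unfolded comp_apply])
    finally have "(f ^^ (n - k z)) w = z"
      by (simp add: inj_funpow[OF bij])
    then show ?thesis
      by (intro exI[of _ "n - k z"]) auto
  qed
  \<comment> \<open>The \<open>2 * n + 1\<close> points from \<open>w\<close> onwards contain all break points on the orbit; starting up to \<open>N\<close>
    steps before \<open>w\<close>, one still meets all of them within \<open>K\<close> steps.\<close>
  define K where "K = 2 * n + 1 + N"
  define x where "x j = (inv f ^^ j) w" for j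
  have x: "(f ^^ j) (x j) = w" for j
    unfolding x_def by (rule undo)
  have shift: "(f ^^ (i + j)) (x j) = (f ^^ i) w" for i j
    by (simp add: funpow_add x)
  have aper_w: "i = i'" if "(f ^^ i) v = (f ^^ i') v" "(f ^^ l) v = y" for i i' l v
  proof -
    have "\<not> i < i'" if eq: "(f ^^ i) v = (f ^^ i') v" and "(f ^^ l) v = y" for i i'
    proof
      assume "i < i'"
      then have "(f ^^ i) v = (f ^^ i) ((f ^^ (i' - i)) v)"
        using eq by (simp flip: funpow_add[THEN fun_cong, unfolded comp_apply])
      then have "v = (f ^^ (i' - i)) v"
        by (simp add: inj_funpow[OF bij])
      then have "(f ^^ (i' - i)) y = y"
        using \<open>(f ^^ l) v = y\<close>
        by (metis add.commute comp_apply funpow_add)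
      then show False
        using aper[of "i' - i"] \<open>i < i'\<close> by simp
    qed
    from this[of i i'] this[of i' i] that show ?thesis
      by (metis linorder_neqE_nat)
  qed
  have x_y: "(f ^^ (n + j)) (x j) = y" for j
    by (simp add: shift w)
  have x_break: "x j \<in> break_points (f ^^ K)" if "j \<le> N" for j
  proof -
    define U where "U = (\<lambda>i. (f ^^ i) (x j)) ` {..<K}"
    have inj: "inj_on (\<lambda>i. (f ^^ i) (x j)) {..<K}"
      by (rule inj_onI) (rule aper_w[OF _ x_y])
    have "jump (f ^^ K) (x j) = (\<Prod>z\<in>U. jump f z)"
      unfolding jump_funpow[OF f] U_def prod.reindex[OF inj] by simp
    also have "\<dots> = (\<Prod>z\<in>B. jump f z)"
    proof (rule prod.mono_neutral_right)
      show "finite U"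
        by (simp add: U_def)
      show "B \<subseteq> U"
      proof
        fix z assume "z \<in> B"
        then obtain i where "i \<le> 2 * n" "(f ^^ i) w = z"
          using B_w by blast
        then have "z = (f ^^ (i + j)) (x j)" "i + j < K"
          using \<open>j \<le> N\<close> by (simp_all add: shift K_def)
        then show "z \<in> U"
          unfolding U_def by blast
      qed
      show "\<forall>z\<in>U - B. jump f z = 1"
      proof
        fix z assume z: "z \<in> U - B"
        then obtain i where "z = (f ^^ i) (x j)"
          by (auto simp: U_def)
        then have "z \<in> full_orbit f (x j)" "y \<in> full_orbit f (x j)"
          using x_y by (auto simp: full_orbit_iff[OF bij])
        then have "z \<in> full_orbit f y"
          by (metis full_orbit_eq_iff[OF bij])
        with z show "jump f z = 1"
          by (simp add: B_def jump_eq_1_iff[OF f])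
      qed
    qed
    also have "\<dots> \<noteq> 1"
      using prod by (simp add: B_def)
    finally show ?thesis
      using jump_eq_1_iff[OF pl_lift_funpow[OF f], of K "x j"] by simp
  qed
  have "inj_on x {..N}"
  proof (rule inj_onI)
    fix j j' assume "x j = x j'"
    then have "(f ^^ (n + j)) (x j) = (f ^^ (n + j')) (x j)"
      using x_y by metis
    from aper_w[OF this x_y] show "j = j'"
      by simp
  qed
  then have "card (x ` {..N}) = Suc N"
    by (simp add: card_image)
  moreover have "card (x ` {..N}) \<le> card (break_points (f ^^ K))"
    by (rule card_mono[OF finite_break_points_funpow[OF f fin]]) (use x_break in auto)
  ultimately show thesis
    by (intro that[of K]) (auto simp: K_def)
qed

section \<open>Each condition forces periodicity\<close>

text \<open>Whichever way \<open>G\<close> moves the points of a gap, one end is fixed with an inner slope larger than \<open>1\<close>,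
and the derivatives of the iterates there are its powers.\<close>

lemma periodic_if_derivatives_bounded:
  assumes f: "pl_lift f F" and G: "is_lift (f ^^ Q) G" and c: "G c = c" and "Q > 0"
    and bound: "\<And>k x. k \<ge> 1 \<Longrightarrow> deriv_right (f ^^ k) x \<le> M" "\<And>k x. k \<ge> 1 \<Longrightarrow> deriv_left (f ^^ k) x \<le> M"
  shows "f ^^ Q = id"
proof (rule ccontr)
  assume "f ^^ Q \<noteq> id"
  from exists_gap[OF G c this] obtain a b where ab: "a < b" "b \<le> a + 1" "G a = a" "G b = b"
    "(\<forall>t\<in>{a<..<b}. G t > t) \<or> (\<forall>t\<in>{a<..<b}. G t < t)" .
  have g: "pl_lift (f ^^ Q) G"
    by (rule pl_lift_change[OF pl_lift_funpow[OF f] G])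
  have fixed: "((f ^^ Q) ^^ i) (to_circle t) = to_circle t" if "G t = t" for t i
    using is_liftD(4)[OF G, of t] that by (induction i) simp_all
  have pow: "deriv_right (f ^^ (Q * k)) (to_circle t) = deriv_right (f ^^ Q) (to_circle t) ^ k"
    "deriv_left (f ^^ (Q * k)) (to_circle t) = deriv_left (f ^^ Q) (to_circle t) ^ k"
    if "G t = t" for t k
    using deriv_funpow[OF g, of k "to_circle t"] fixed[OF that] by (simp_all add: funpow_mult)
  have no: "D \<le> 1" if D: "\<And>k. k \<ge> 1 \<Longrightarrow> D ^ k \<le> M" for D
  proof (rule ccontr)
    assume "\<not> D \<le> 1"
    then obtain k where k: "max M 1 < D ^ k"
      using real_arch_pow[of D "max M 1"] by (meson not_le)
    then have "k \<noteq> 0"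
      by (cases k) auto
    with D[of k] k show False
      by simp
  qed
  have "deriv_right (f ^^ Q) (to_circle a) \<le> 1"
    by (rule no) (use bound(1) pow(1)[OF ab(3)] \<open>Q > 0\<close> in \<open>metis mult_pos_pos less_eq_Suc_le One_nat_def\<close>)
  moreover have "deriv_left (f ^^ Q) (to_circle b) \<le> 1"
    by (rule no) (use bound(2) pow(2)[OF ab(4)] \<open>Q > 0\<close> in \<open>metis mult_pos_pos less_eq_Suc_le One_nat_def\<close>)
  ultimately show False
    using slopes_at_gap_ends(1,4)[OF g ab(1,3,4)] ab(5) by linarith
qed

text \<open>The inner slopes of \<open>G\<close> at the ends of a gap are different because they lie on opposite sides of \<open>1\<close>.\<close>

lemma aperiodic_nontrivial_orbit:
  assumes f: "pl_lift f F" and fin: "finite (break_points f)"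
    and G: "is_lift (f ^^ Q) G" and c: "G c = c" and neq: "f ^^ Q \<noteq> id"
  obtains y where "y \<in> break_points f" "\<And>k. k > 0 \<Longrightarrow> (f ^^ k) y \<noteq> y"
    "(\<Prod>z\<in>break_points f \<inter> full_orbit f y. jump f z) \<noteq> 1"
proof -
  from exists_gap[OF G c neq] obtain a b where ab: "a < b" "b \<le> a + 1" "G a = a" "G b = b"
    "(\<forall>t\<in>{a<..<b}. G t > t) \<or> (\<forall>t\<in>{a<..<b}. G t < t)" .
  have g: "pl_lift (f ^^ Q) G"
    by (rule pl_lift_change[OF pl_lift_funpow[OF f] G])
  have "deriv_left (f ^^ Q) (to_circle b) \<noteq> deriv_right (f ^^ Q) (to_circle a)"
    using slopes_at_gap_ends[OF g ab(1,3,4)] ab(5) by fastforce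
  from nontrivial_orbit_product[OF f fin G ab(1-4) this]
  obtain y i where y: "y \<in> break_points f" "y \<in> (f ^^ i) ` to_circle ` {a<..<b}"
    "(\<Prod>z\<in>break_points f \<inter> full_orbit f y. jump f z) \<noteq> 1"
    by blast
  show thesis
    by (rule that[OF y(1) gap_aperiodic[OF pl_lift_is_lift[OF f] G ab(2-5) y(2)] y(3)])
qed

lemma periodic_if_break_points_bounded:
  assumes f: "pl_lift f F" and fin: "finite (break_points f)"
    and G: "is_lift (f ^^ Q) G" and c: "G c = c"
    and bound: "\<And>k. k \<ge> 1 \<Longrightarrow> card (break_points (f ^^ k)) \<le> N"
  shows "f ^^ Q = id"
proof (rule ccontr)
  assume "f ^^ Q \<noteq> id"
  then obtain y where "\<And>k. k > 0 \<Longrightarrow> (f ^^ k) y \<noteq> y"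
    "(\<Prod>z\<in>break_points f \<inter> full_orbit f y. jump f z) \<noteq> 1"
    using aperiodic_nontrivial_orbit[OF f fin G c] by metis
  from unbounded_break_points[OF f fin this] obtain K where "K \<ge> 1" "card (break_points (f ^^ K)) > N" .
  with bound show False
    by (meson not_less)
qed

lemma rotation_funpow: "(rotation \<omega> ^^ k) (to_circle x) = to_circle (x + real k * \<omega>)"
  by (induction k) (simp_all add: rotation.abs_eq algebra_simps)

text \<open>The conjugacy carries a fixed point of \<open>f ^^ Q\<close> to one of the rotation by \<open>Q * \<omega>\<close>, so \<open>Q * \<omega>\<close> is
an integer and that rotation fixes every point.\<close>

lemma periodic_if_conjugate_to_rotation:
  assumes "inj h" and conj: "h \<circ> f = rotation \<omega> \<circ> h" and fixed: "(f ^^ Q) x = x"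
  shows "f ^^ Q = id"
proof -
  have iter: "h ((f ^^ k) y) = (rotation \<omega> ^^ k) (h y)" for k y
    using conj by (induction k) (auto simp: fun_eq_iff)
  obtain t where t: "to_circle t = h x"
    by (rule to_circle_representative)
  have "to_circle (t + real Q * \<omega>) = to_circle t"
    using iter[of Q x] fixed by (simp add: rotation_funpow flip: t)
  then have int: "real Q * \<omega> \<in> \<int>"
    by (simp add: to_circle_eq_iff)
  have "(f ^^ Q) y = y" for y
  proof -
    obtain s where s: "to_circle s = h y"
      by (rule to_circle_representative)
    have "to_circle (s + real Q * \<omega>) = to_circle s"
      using int by (simp add: to_circle_eq_iff)
    then have "h ((f ^^ Q) y) = h y"
      unfolding iter by (simp add: rotation_funpow flip: s)
    with \<open>inj h\<close> show ?thesis
      by (rule injD)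
  qed
  then show ?thesis
    by (auto simp: id_def)
qed

lemma invariant_measure_funpow:
  assumes inv: "invariant_measure f \<nu>" and f: "is_lift f F" and A: "A \<in> sets borel"
  shows "emeasure \<nu> ((f ^^ k) -` A) = emeasure \<nu> A"
proof (induction k)
  case (Suc k)
  have "(f ^^ k) -` A \<in> sets borel"
    using borel_measurable_of_lift[OF is_lift_funpow[OF f], of k] A by (auto dest: measurable_sets_borel)
  then have "emeasure \<nu> (f -` ((f ^^ k) -` A)) = emeasure \<nu> ((f ^^ k) -` A)"
    using inv unfolding invariant_measure_def by simp
  moreover have "(f ^^ Suc k) -` A = f -` ((f ^^ k) -` A)"
    unfolding funpow_Suc_right vimage_comp ..
  ultimately show ?case
    using Suc by (simp only:)
qed simp

text \<open>The preimages of a wandering set are disjoint and have equal measure, so there is room for only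
  finitely many of them unless they are null.\<close>

lemma wandering_set_null:
  assumes "prob_space \<nu>" and inv: "invariant_measure f \<nu>" and f: "is_lift f F" and U: "U \<in> sets borel"
    and wander: "\<And>k z. k > 0 \<Longrightarrow> z \<in> U \<Longrightarrow> ((f ^^ Q) ^^ k) z \<notin> U"
  shows "emeasure \<nu> U = 0"
proof -
  interpret prob_space \<nu> by fact
  define V where "V k = ((f ^^ Q) ^^ k) -` U" for k
  have sets: "sets \<nu> = sets borel"
    using inv by (simp add: invariant_measure_def)
  have V_sets: "V k \<in> sets \<nu>" for k
    unfolding V_def sets
    using borel_measurable_of_lift[OF is_lift_funpow[OF is_lift_funpow[OF f]]] U
    by (rule measurable_sets_borel)
  have V_measure: "measure \<nu> (V k) = measure \<nu> U" for k
    unfolding V_def funpow_mult using invariant_measure_funpow[OF inv f U] by (simp add: measure_def)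
  have "V i \<inter> V j = {}" if "i < j" for i j
  proof -
    have "((f ^^ Q) ^^ j) z = ((f ^^ Q) ^^ (j - i)) (((f ^^ Q) ^^ i) z)" for z
      using that funpow_add[of "j - i" i "f ^^ Q"] by simp
    then show ?thesis
      using wander[of "j - i"] that by (auto simp: V_def)
  qed
  then have disj: "disjoint_family V"
    unfolding disjoint_family_on_def by (metis Int_commute linorder_neqE_nat)
  have "real n * measure \<nu> U \<le> 1" for n
  proof -
    have "real n * measure \<nu> U = (\<Sum>i<n. measure \<nu> (V i))"
      by (simp add: V_measure)
    also have "\<dots> = measure \<nu> (\<Union>i<n. V i)"
      by (rule finite_measure_finite_Union[symmetric])
        (use V_sets disjoint_family_on_mono[OF _ disj] in auto)
    also have "\<dots> \<le> 1"
      by (rule prob_le_1)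
    finally show ?thesis .
  qed
  then have "measure \<nu> U = 0"
    using reals_Archimedean3[of "measure \<nu> U"] by (meson measure_le_0_iff not_less)
  then show ?thesis
    by (simp add: emeasure_eq_measure)
qed

text \<open>For a point \<open>x\<close> of a gap, the open interval between \<open>x\<close> and \<open>G x\<close> is wandering: iterates of
its points lie beyond \<open>G x\<close>, yet stay in the gap, which embeds in the circle.\<close>

lemma periodic_if_invariant_measure:
  assumes f: "is_lift f F" and G: "is_lift (f ^^ Q) G" and c: "G c = c"
    and \<nu>: "prob_space \<nu>" "invariant_measure f \<nu>" and supp: "measure_support \<nu> = UNIV"
  shows "f ^^ Q = id"
proof (rule ccontr)
  assume "f ^^ Q \<noteq> id"
  from exists_gap[OF G c this] obtain a b where ab: "a < b" "b \<le> a + 1" "G a = a" "G b = b"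
    "(\<forall>t\<in>{a<..<b}. G t > t) \<or> (\<forall>t\<in>{a<..<b}. G t < t)" .
  define x where "x = (a + b) / 2"
  have x_in: "x \<in> {a<..<b}"
    using ab(1) by (simp add: x_def)
  moreover have "G x \<in> {a<..<b}"
    using gap_iterate(1)[OF G ab(3-5) x_in, of 1] by simp
  moreover have "G x \<noteq> x"
    using ab(5) x_in by (metis less_irrefl)
  ultimately have x: "x \<in> {a<..<b}" "G x \<in> {a<..<b}" "G x \<noteq> x"
    by blast+
  define W where "W = {min x (G x)<..<max x (G x)}"
  have W: "W \<subseteq> {a<..<b}"
    using x by (auto simp: W_def)
  have W_iter: "(G ^^ Suc k) t \<notin> W" if t: "t \<in> W" for k t
  proof -
    have tab: "t \<in> {a<..<b}"
      using W t by blast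
    show ?thesis
      using ab(5)
    proof
      assume up: "\<forall>t\<in>{a<..<b}. G t > t"
      then have "x < G x" "x < t"
        using x t by (auto simp: W_def min_def split: if_splits)
      then have "G x < (G ^^ Suc k) t"
        using gap_iterate(2)[OF G ab(3-5) tab up, of k] lift_less_iff[OF G, of x t] by simp
      with \<open>x < G x\<close> show ?thesis
        by (simp add: W_def)
    next
      assume down: "\<forall>t\<in>{a<..<b}. G t < t"
      then have "G x < x" "t < x"
        using x t by (auto simp: W_def max_def split: if_splits)
      then have "(G ^^ Suc k) t < G x"
        using gap_iterate(3)[OF G ab(3-5) tab down, of k] lift_less_iff[OF G, of t x] by simp
      with \<open>G x < x\<close> show ?thesis
        by (simp add: W_def)
    qed
  qed
  define U where "U = to_circle ` W"
  have "open U"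
    unfolding U_def by (rule open_to_circle_image) (simp add: W_def)
  have "emeasure \<nu> U = 0"
  proof (rule wandering_set_null[OF \<nu> f])
    show "U \<in> sets borel"
      using \<open>open U\<close> by simp
  next
    fix k :: nat and z assume "k > 0" "z \<in> U"
    then obtain t j where t: "t \<in> W" "z = to_circle t" "k = Suc j"
      by (auto simp: U_def gr0_conv_Suc)
    have Gt: "(G ^^ k) t \<in> {a<..<b}"
      using gap_iterate(1)[OF G ab(3-5)] W t(1) by blast
    show "((f ^^ Q) ^^ k) z \<notin> U"
    proof
      assume "((f ^^ Q) ^^ k) z \<in> U"
      then obtain s where s: "s \<in> W" "to_circle ((G ^^ k) t) = to_circle s"
        by (auto simp: U_def t(2) is_liftD(4)[OF is_lift_funpow[OF G]])
      then have "(G ^^ k) t = s"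
        using inj_on_to_circle[OF ab(2)] Gt W by (auto dest: inj_onD)
      with s(1) W_iter[OF t(1)] t(3) show False
        by blast
    qed
  qed
  moreover have "(x + G x) / 2 \<in> W"
    using x(3) by (auto simp: W_def min_def max_def field_simps)
  then have "to_circle ((x + G x) / 2) \<in> U"
    by (simp add: U_def)
  ultimately show False
    using supp \<open>open U\<close> unfolding measure_support_def by force
qed


section \<open>Lebesgue measure on the circle\<close>

lemma emeasure_circle_lebesgue:
  assumes "A \<in> sets borel"
  shows "emeasure circle_lebesgue A = emeasure lborel (to_circle -` A \<inter> {0..<1})"
proof -
  have "to_circle \<in> measurable (restrict_space lborel {0..<1}) borel"
    by (intro measurable_restrict_space1) simp
  then show ?thesis
    unfolding circle_lebesgue_def using assms
    by (simp add: emeasure_distr space_restrict_space emeasure_restrict_space)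
qed

lemma space_circle_lebesgue [simp]: "space circle_lebesgue = UNIV"
  and sets_circle_lebesgue [simp, measurable_cong]: "sets circle_lebesgue = sets borel"
  by (simp_all add: circle_lebesgue_def)

lemma prob_space_circle_lebesgue: "prob_space circle_lebesgue"
  by (rule prob_spaceI) (simp add: emeasure_circle_lebesgue)

text \<open>The preimage of a set on the line is a countable union of integer translates of its part in \<open>[0, 1)\<close>.\<close>

lemma null_sets_circle_lebesgue_iff:
  assumes A: "A \<in> sets borel"
  shows "A \<in> null_sets circle_lebesgue \<longleftrightarrow> negligible (to_circle -` A)"
proof -
  have V: "to_circle -` A \<in> sets borel"
    using measurable_to_circle A by (rule measurable_sets_borel)
  have "negligible (to_circle -` A) \<longleftrightarrow> to_circle -` A \<in> null_sets lborel"
    unfolding negligible_iff_null_sets by (rule null_sets_completion_iff) (simp add: V)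
  also have "\<dots> \<longleftrightarrow> to_circle -` A \<inter> {0..<1} \<in> null_sets lborel"
  proof
    assume "to_circle -` A \<in> null_sets lborel"
    then show "to_circle -` A \<inter> {0..<1} \<in> null_sets lborel"
      by (rule null_sets_subset) (use V in auto)
  next
    assume N: "to_circle -` A \<inter> {0..<1} \<in> null_sets lborel"
    have "to_circle -` A = (\<Union>k. {x. x - of_int k \<in> to_circle -` A \<inter> {0..<1}})"
    proof (intro equalityI subsetI)
      fix x assume x: "x \<in> to_circle -` A"
      have "to_circle (x - of_int \<lfloor>x\<rfloor>) = to_circle x"
        by (simp add: to_circle_eq_iff)
      moreover have "0 \<le> x - of_int \<lfloor>x\<rfloor>" "x - of_int \<lfloor>x\<rfloor> < 1"
        by linarith+
      ultimately show "x \<in> (\<Union>k. {x. x - of_int k \<in> to_circle -` A \<inter> {0..<1}})"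
        using x by (intro UN_I[of "\<lfloor>x\<rfloor>"]) auto
    next
      fix x assume "x \<in> (\<Union>k. {x. x - of_int k \<in> to_circle -` A \<inter> {0..<1}})"
      then obtain k where "to_circle (x - of_int k) \<in> A"
        by auto
      moreover have "to_circle (x - of_int k) = to_circle x"
        by (simp add: to_circle_eq_iff)
      ultimately show "x \<in> to_circle -` A"
        by simp
    qed
    also have "\<dots> \<in> null_sets lborel"
      by (intro null_sets_UN null_sets_translation N)
    finally show "to_circle -` A \<in> null_sets lborel" .
  qed
  also have "\<dots> \<longleftrightarrow> A \<in> null_sets circle_lebesgue"
    using A V by (simp add: null_sets_def emeasure_circle_lebesgue)
  finally show ?thesis
    by simp
qed

text \<open>The inverse of a piecewise linear lift is locally Lipschitz, since slopes are positive.\<close>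

lemma null_sets_vimage_pl:
  assumes f: "pl_lift f F" and A: "A \<in> null_sets circle_lebesgue"
  shows "f -` A \<in> null_sets circle_lebesgue"
proof -
  have F: "is_lift f F"
    by (rule pl_lift_is_lift[OF f])
  define N where "N = to_circle -` A"
  have A_borel: "A \<in> sets borel"
    using A by auto
  have N: "negligible N"
    using A null_sets_circle_lebesgue_iff[OF A_borel] by (simp add: N_def)
  define E where "E = inv F"
  have EF: "E (F t) = t" for t
    unfolding E_def using strict_mono_imp_inj_on[OF is_liftD(2)[OF F]] by (simp add: inv_f_f)
  have FE: "F (E y) = y" for y
    unfolding E_def by (rule surj_f_inv_f[OF surj_lift[OF F]])
  have "negligible (E ` N)"
  proof (rule negligible_locally_Lipschitz_image)
    fix y assume "y \<in> N"
    define t where "t = E y"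
    define r where "r = deriv_right f (to_circle t)"
    define l where "l = deriv_left f (to_circle t)"
    have pos: "r > 0" "l > 0"
      unfolding r_def l_def by (rule pl_deriv_pos[OF f])+
    obtain d where d: "d > 0" "\<And>x. t \<le> x \<Longrightarrow> x < t + d \<Longrightarrow> F x = F t + r * (x - t)"
      using right_slopeE[OF pl_right_slope[OF f, of t]] unfolding r_def by blast
    obtain e where e: "e > 0" "\<And>x. x \<le> t \<Longrightarrow> t - e < x \<Longrightarrow> F x = F t + l * (x - t)"
      using left_slopeE[OF pl_left_slope[OF f, of t]] unfolding l_def by blast
    have "norm (E z - E y) \<le> (1 / r + 1 / l) * norm (z - y)" if "z \<in> {F (t - e)<..<F (t + d)}" for z
    proof -
      define s where "s = E z"
      have z: "z = F s" and y: "y = F t"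
        by (simp_all add: s_def t_def FE)
      have s: "t - e < s" "s < t + d"
        using that unfolding z by (simp_all add: lift_less_iff[OF F])
      have "\<bar>s - t\<bar> \<le> 1 / r * \<bar>F s - F t\<bar> + 1 / l * \<bar>F s - F t\<bar>"
      proof (cases "t \<le> s")
        case True
        then have "1 / r * \<bar>F s - F t\<bar> = \<bar>s - t\<bar>"
          using d(2)[OF True s(2)] pos by (simp add: abs_mult)
        moreover have "0 \<le> 1 / l * \<bar>F s - F t\<bar>"
          using pos by simp
        ultimately show ?thesis
          by linarith
      next
        case False
        then have "1 / l * \<bar>F s - F t\<bar> = \<bar>s - t\<bar>"
          using e(2)[of s] s(1) pos by (simp add: abs_mult)
        moreover have "0 \<le> 1 / r * \<bar>F s - F t\<bar>"
          using pos by simp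
        ultimately show ?thesis
          by linarith
      qed
      then show ?thesis
        unfolding z y EF by (simp add: algebra_simps)
    qed
    moreover have "y \<in> {F (t - e)<..<F (t + d)}"
      using lift_less_iff[OF F, of "t - e" t] lift_less_iff[OF F, of t "t + d"] d(1) e(1) FE[of y]
      by (simp add: t_def)
    ultimately show "\<exists>T B. open T \<and> y \<in> T \<and> (\<forall>z\<in>N \<inter> T. norm (E z - E y) \<le> B * norm (z - y))"
      by (intro exI[of _ "{F (t - e)<..<F (t + d)}"] exI[of _ "1 / r + 1 / l"]) auto
  qed (use N in auto)
  moreover have "E ` N = to_circle -` (f -` A)"
  proof (rule set_eqI)
    fix t
    have "t \<in> E ` N \<longleftrightarrow> F t \<in> N"
      using EF FE by (metis image_iff)
    then show "t \<in> E ` N \<longleftrightarrow> t \<in> to_circle -` (f -` A)"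
      by (simp add: N_def is_liftD(4)[OF F])
  qed
  moreover have "f -` A \<in> sets borel"
    using borel_measurable_of_lift[OF F] A_borel by (rule measurable_sets_borel)
  ultimately show ?thesis
    by (simp add: null_sets_circle_lebesgue_iff)
qed

lemma emeasure_circle_lebesgue_open_pos:
  assumes "open U" "U \<noteq> {}"
  shows "emeasure circle_lebesgue U > 0"
proof -
  have "open (to_circle -` U)"
    using assms(1) by (simp add: open_circle_def)
  moreover have "to_circle -` U \<noteq> {}"
    using assms(2) to_circle_representative by (metis empty_iff equals0I vimage_eq)
  ultimately have "U \<notin> null_sets circle_lebesgue"
    using null_sets_circle_lebesgue_iff[of U] assms(1) open_not_negligible by auto
  then show ?thesis
    using assms(1) by (auto simp: null_sets_def zero_less_iff_neq_zero)
qed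

section \<open>Periodicity implies every condition\<close>

lemma funpow_periodic:
  assumes "f ^^ Q = id"
  shows "f ^^ k = f ^^ (k mod Q)"
proof
  fix x
  show "(f ^^ k) x = (f ^^ (k mod Q)) x"
    using funpow_mod_eq[of Q f x k] assms by simp
qed

text \<open>For periodic \<open>f\<close> going backwards is the same as going forwards, and \<open>Q\<close> steps suffice.\<close>

lemma finite_full_orbit:
  assumes "bij f" "f ^^ Q = id" "Q > 0"
  shows "finite (full_orbit f y)"
proof (rule finite_subset)
  show "full_orbit f y \<subseteq> (\<lambda>i. (f ^^ i) y) ` {..<Q}"
  proof
    fix z assume "z \<in> full_orbit f y"
    then obtain k where "(f ^^ k) y = z \<or> (f ^^ k) z = y"
      unfolding full_orbit_iff[OF assms(1)] by blast
    then have "\<exists>k. (f ^^ k) y = z"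
    proof
      assume k: "(f ^^ k) z = y"
      have "k \<le> k * Q"
        using \<open>Q > 0\<close> by simp
      then have "(f ^^ (k * Q - k)) y = (f ^^ (k * Q)) z"
        unfolding k[symmetric] by (simp flip: funpow_add[THEN fun_cong, unfolded comp_apply])
      also have "\<dots> = z"
        using funpow_periodic[OF assms(2), of "k * Q"] by simp
      finally show ?thesis
        by blast
    qed blast
    then obtain k where "z = (f ^^ (k mod Q)) y"
      using funpow_periodic[OF assms(2)] by metis
    then show "z \<in> (\<lambda>i. (f ^^ i) y) ` {..<Q}"
      using \<open>Q > 0\<close> by simp
  qed
qed simp

text \<open>Multiplying the jumps of \<open>f ^^ Q = id\<close> over an orbit gives the \<open>Q\<close>-th power of the product of
  the jumps of \<open>f\<close> over that orbit, because \<open>f\<close> permutes the orbit; a positive number with \<open>Q\<close>-th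
  power \<open>1\<close> is \<open>1\<close>.\<close>

lemma orbit_product_trivial_if_periodic:
  assumes f: "pl_lift f F" and per: "f ^^ Q = id" and "Q > 0"
  shows "(\<Prod>z\<in>break_points f \<inter> full_orbit f y. jump f z) = 1"
proof -
  define U where "U = full_orbit f y"
  have bij: "bij f"
    by (rule bij_of_lift[OF pl_lift_is_lift[OF f]])
  have finU: "finite U"
    unfolding U_def by (rule finite_full_orbit[OF bij per \<open>Q > 0\<close>])
  have step: "f w \<in> U \<longleftrightarrow> w \<in> U" for w
    unfolding U_def by (metis full_orbit_eq_iff[OF bij] full_orbit_step[OF bij])
  have "bij_betw f U U"
    unfolding bij_betw_def
  proof
    show "inj_on f U"
      using bij by (rule inj_on_subset[OF bij_is_inj]) simp
    show "f ` U = U"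
      using step bij_is_surj[OF bij] by (auto; metis image_iff surjD)
  qed
  then have perm: "(\<Prod>z\<in>U. g (f z)) = (\<Prod>z\<in>U. g z)" for g :: "circle \<Rightarrow> real"
    by (rule prod.reindex_bij_betw)
  have shift: "(\<Prod>z\<in>U. jump f ((f ^^ i) z)) = (\<Prod>z\<in>U. jump f z)" for i
  proof (induction i)
    case (Suc i)
    then show ?case
      using perm[of "\<lambda>z. jump f ((f ^^ i) z)"] by (simp add: funpow_swap1)
  qed simp
  have "jump (f ^^ Q) z = 1" for z
    by (simp add: per jump_def deriv_id)
  then have "1 = (\<Prod>z\<in>U. \<Prod>i<Q. jump f ((f ^^ i) z))"
    by (simp flip: jump_funpow[OF f])
  also have "\<dots> = (\<Prod>i<Q. \<Prod>z\<in>U. jump f ((f ^^ i) z))"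
    by (rule prod.swap)
  also have "\<dots> = (\<Prod>z\<in>U. jump f z) ^ Q"
    by (simp add: shift)
  finally have "(\<Prod>z\<in>U. jump f z) ^ Q = 1 ^ Q"
    by simp
  moreover have "(\<Prod>z\<in>U. jump f z) > 0"
    by (intro prod_pos) (simp add: jump_pos[OF f])
  ultimately have "(\<Prod>z\<in>U. jump f z) = 1"
    using power_eq_iff_eq_base[OF \<open>Q > 0\<close>, of "\<Prod>z\<in>U. jump f z" 1] by simp
  moreover have "(\<Prod>z\<in>U. jump f z) = (\<Prod>z\<in>break_points f \<inter> U. jump f z)"
    by (rule prod.mono_neutral_right[OF finU]) (auto simp: jump_eq_1_iff[OF f])
  ultimately show ?thesis
    by (simp add: U_def)
qed

text \<open>A break point that is alone on its orbit would have its own jump as jump product, which is not \<open>1\<close>.\<close>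

lemma break_orbit_conditions_if_periodic:
  assumes f: "pl_lift f F" and per: "f ^^ Q = id" and "Q > 0" and y: "y \<in> break_points f"
  shows "\<exists>z\<in>break_points f. z \<noteq> y \<and> z \<in> full_orbit f y"
proof (rule ccontr)
  assume "\<not> ?thesis"
  moreover have "y \<in> full_orbit f y"
    by (auto simp: full_orbit_def image_iff intro!: exI[of _ 0])
  ultimately have "break_points f \<inter> full_orbit f y = {y}"
    using y by blast
  then have "jump f y = 1"
    using orbit_product_trivial_if_periodic[OF f per \<open>Q > 0\<close>, of y] by simp
  with y show False
    by (simp add: jump_eq_1_iff[OF f])
qed

lemma break_points_bounded_if_periodic:
  assumes f: "pl_lift f F" and fin: "finite (break_points f)" and per: "f ^^ Q = id" and "Q > 0"
  shows "card (break_points (f ^^ k)) \<le> (\<Sum>j<Q. card (break_points (f ^^ j)))"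
  unfolding funpow_periodic[OF per, of k] using \<open>Q > 0\<close>
  by (intro member_le_sum[of _ _ "\<lambda>j. card (break_points (f ^^ j))"]) auto

lemma derivatives_bounded_if_periodic:
  assumes f: "pl_lift f F" and per: "f ^^ Q = id" and "Q > 0"
    and M: "\<And>x. deriv_right f x \<le> M" "\<And>x. deriv_left f x \<le> M"
  shows "deriv_right (f ^^ k) x \<le> (\<Sum>j<Q. M ^ j)" "deriv_left (f ^^ k) x \<le> (\<Sum>j<Q. M ^ j)"
proof -
  have "0 \<le> M"
    using pl_deriv_pos(1)[OF f] M(1) by (meson less_le_trans less_imp_le)
  define j where "j = k mod Q"
  have "M ^ j \<le> (\<Sum>j<Q. M ^ j)"
    using \<open>Q > 0\<close> \<open>0 \<le> M\<close> by (intro member_le_sum) (auto simp: j_def)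
  moreover have "deriv_right (f ^^ j) x \<le> (\<Prod>i<j. M)" "deriv_left (f ^^ j) x \<le> (\<Prod>i<j. M)"
    unfolding deriv_funpow[OF f]
    by (intro prod_mono; simp add: M less_imp_le[OF pl_deriv_pos(1)[OF f]] less_imp_le[OF pl_deriv_pos(2)[OF f]])+
  ultimately show "deriv_right (f ^^ k) x \<le> (\<Sum>j<Q. M ^ j)" "deriv_left (f ^^ k) x \<le> (\<Sum>j<Q. M ^ j)"
    unfolding funpow_periodic[OF per, of k] j_def[symmetric] by simp_all
qed

text \<open>The average of the lifts of \<open>f ^^ i\<close> over one period conjugates \<open>f\<close> to a rotation: composing it
  with \<open>F\<close> replaces the first summand \<open>x\<close> by \<open>F\<^sup>Q x = x + p\<close>.\<close>

lemma conjugate_to_rotation_if_periodic: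
  assumes f: "pl_lift f F" and fin: "finite (break_points f)" and "Q > 0"
    and FQ: "\<And>x. (F ^^ Q) x = x + of_int p"
  obtains h where "pwl h" "h \<circ> f = rotation (of_int p / real Q) \<circ> h"
proof -
  define H where "H x = (\<Sum>i<Q. (F ^^ i) x) / real Q" for x
  have Fi: "is_lift (f ^^ i) (F ^^ i)" for i
    by (rule is_lift_funpow[OF pl_lift_is_lift[OF f]])
  have "continuous_on UNIV H"
    unfolding H_def using \<open>Q > 0\<close> is_liftD(1)[OF Fi] by (intro continuous_intros) auto
  moreover have "strict_mono H"
    unfolding H_def using \<open>Q > 0\<close> lift_less_iff[OF Fi]
    by (intro strict_monoI divide_strict_right_mono sum_strict_mono) auto
  moreover have "H (x + 1) = H x + 1" for x
    unfolding H_def using \<open>Q > 0\<close> by (simp add: is_liftD(3)[OF Fi] sum.distrib add_divide_distrib)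
  ultimately obtain h where h: "is_lift h H" "orientation_preserving_homeo h"
    by (rule lift_induces_homeo)
  have "pl_lift h H" "finite (break_points h)"
    using finite_break_points_average[of h "\<lambda>i. F ^^ i" "{..<Q}" "real Q" "\<lambda>i. f ^^ i"] h(1) \<open>Q > 0\<close>
      pl_lift_funpow[OF f] finite_break_points_funpow[OF f fin]
    unfolding H_def[abs_def] by auto
  then have "pwl h"
    by (intro pwl_of_pl_lift h(2))
  moreover have "h \<circ> f = rotation (of_int p / real Q) \<circ> h"
  proof
    fix x
    obtain t where t: "to_circle t = x"
      by (rule to_circle_representative)
    have "(\<Sum>i<Q. (F ^^ i) (F t)) + t = (\<Sum>i<Suc Q. (F ^^ i) t)"
      unfolding sum.lessThan_Suc_shift by (simp add: funpow_swap1)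
    also have "\<dots> = (\<Sum>i<Q. (F ^^ i) t) + (t + of_int p)"
      by (simp add: FQ)
    finally have "H (F t) = H t + of_int p / real Q"
      by (simp add: H_def add_divide_distrib)
    then show "(h \<circ> f) x = (rotation (of_int p / real Q) \<circ> h) x"
      by (simp add: is_liftD(4)[OF pl_lift_is_lift[OF f]] is_liftD(4)[OF h(1)] rotation.abs_eq flip: t)
  qed
  ultimately show thesis
    by (rule that)
qed

text \<open>The invariant measure is the average over \<open>i < Q\<close> of the images of Lebesgue measure under \<open>f ^^ i\<close>,
written as a single image measure: choose \<open>i\<close> uniformly and a point by Lebesgue measure, and apply
\<open>f ^^ i\<close>. The summand \<open>i = 0\<close> gives full support, and absolute continuity holds because preimages
of null sets under \<open>f ^^ i\<close> are null sets.\<close>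

lemma invariant_measure_if_periodic:
  assumes f: "pl_lift f F" and per: "f ^^ Q = id" and "Q > 0"
  obtains \<nu> where "prob_space \<nu>" "invariant_measure f \<nu>"
    "absolutely_continuous circle_lebesgue \<nu>" "measure_support \<nu> = UNIV"
proof -
  interpret lebesgue: prob_space circle_lebesgue
    by (rule prob_space_circle_lebesgue)
  define \<mu> where "\<mu> = uniform_count_measure {..<Q} \<Otimes>\<^sub>M circle_lebesgue"
  define \<nu> where "\<nu> = distr \<mu> borel (\<lambda>(i, x). (f ^^ i) x)"
  have fi: "f ^^ i \<in> borel_measurable borel" for i
    by (rule borel_measurable_of_lift[OF is_lift_funpow[OF pl_lift_is_lift[OF f]]])
  have "(\<lambda>(i, x). (f ^^ i) x) \<in> borel_measurable (count_space {..<Q} \<Otimes>\<^sub>M circle_lebesgue)"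
  proof (rule measurable_pair_measure_countable1)
    show "(\<lambda>y. case (i, y) of (i, x) \<Rightarrow> (f ^^ i) x) \<in> borel_measurable circle_lebesgue" for i
      using fi[of i] by (simp cong: measurable_cong_sets)
  qed (rule countable_finite, simp)
  also have "borel_measurable (count_space {..<Q} \<Otimes>\<^sub>M circle_lebesgue) = borel_measurable \<mu>"
    unfolding \<mu>_def
    by (intro measurable_cong_sets sets_pair_measure_cong sets_uniform_count_measure_count_space[symmetric] refl)
  finally have meas: "(\<lambda>(i, x). (f ^^ i) x) \<in> borel_measurable \<mu>" .
  have \<nu>: "emeasure \<nu> A = (\<Sum>i<Q. emeasure circle_lebesgue ((f ^^ i) -` A)) / real Q"
    if "A \<in> sets borel" for A
  proof -
    define S where "S = (\<lambda>(i, x). (f ^^ i) x) -` A \<inter> space \<mu>"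
    have "S \<in> sets \<mu>"
      unfolding S_def using meas that by (rule measurable_sets)
    have "emeasure \<nu> A = emeasure \<mu> S"
      unfolding \<nu>_def S_def by (rule emeasure_distr[OF meas that])
    also have "\<dots> = (\<integral>\<^sup>+i. emeasure circle_lebesgue (Pair i -` S) \<partial>uniform_count_measure {..<Q})"
      unfolding \<mu>_def by (rule lebesgue.emeasure_pair_measure_alt[OF \<open>S \<in> sets \<mu>\<close>[unfolded \<mu>_def]])
    also have "\<dots> = (\<Sum>i<Q. ennreal (1 / real Q) * emeasure circle_lebesgue (Pair i -` S))"
      unfolding uniform_count_measure_def by (subst nn_integral_point_measure_finite) simp_all
    also have "\<dots> = (\<Sum>i<Q. ennreal (1 / real Q) * emeasure circle_lebesgue ((f ^^ i) -` A))"
    proof (rule sum.cong[OF refl])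
      fix i assume "i \<in> {..<Q}"
      then have "Pair i -` S = (f ^^ i) -` A"
        by (auto simp: S_def \<mu>_def space_pair_measure space_uniform_count_measure)
      then show "ennreal (1 / real Q) * emeasure circle_lebesgue (Pair i -` S)
          = ennreal (1 / real Q) * emeasure circle_lebesgue ((f ^^ i) -` A)"
        by simp
    qed
    also have "\<dots> = ennreal (1 / real Q) * (\<Sum>i<Q. emeasure circle_lebesgue ((f ^^ i) -` A))"
      by (simp only: sum_distrib_left)
    also have "\<dots> = (\<Sum>i<Q. emeasure circle_lebesgue ((f ^^ i) -` A)) / real Q"
      using \<open>Q > 0\<close> by (simp add: divide_ennreal_def inverse_ennreal mult.commute divide_inverse)
    finally show ?thesis .
  qed
  have sets: "sets \<nu> = sets borel" and space: "space \<nu> = UNIV"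
    by (simp_all add: \<nu>_def)
  have vimage: "(f ^^ i) -` A \<in> sets borel" if "A \<in> sets borel" for A i
    using fi that by (rule measurable_sets_borel)
  have prob: "prob_space \<nu>"
  proof (rule prob_spaceI)
    have "emeasure circle_lebesgue UNIV = 1"
      using lebesgue.emeasure_space_1 by simp
    then show "emeasure \<nu> (space \<nu>) = 1"
      using \<open>Q > 0\<close> by (simp add: space \<nu> ennreal_of_nat_eq_real_of_nat divide_ennreal)
  qed
  have inv: "invariant_measure f \<nu>"
    unfolding invariant_measure_def sets
  proof (intro conjI ballI refl)
    fix A :: "circle set" assume A: "A \<in> sets borel"
    define a where "a i = emeasure circle_lebesgue ((f ^^ i) -` A)" for i
    have "(f ^^ i) -` (f -` A) = (f ^^ Suc i) -` A" for i
      by auto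
    then have "(\<Sum>i<Q. emeasure circle_lebesgue ((f ^^ i) -` (f -` A))) = (\<Sum>i<Q. a (Suc i))"
      by (simp add: a_def)
    also have "\<dots> = (\<Sum>i<Q. a i)"
    proof -
      obtain R where "Q = Suc R"
        using \<open>Q > 0\<close> gr0_implies_Suc by blast
      moreover have "a Q = a 0"
        by (simp add: a_def per)
      ultimately show ?thesis
        unfolding \<open>Q = Suc R\<close> sum.lessThan_Suc_shift[of a] sum.lessThan_Suc[of "\<lambda>i. a (Suc i)"]
        by (simp add: add.commute)
    qed
    finally show "emeasure \<nu> (f -` A) = emeasure \<nu> A"
      using \<nu>[OF A] \<nu>[OF vimage[OF A, of 1]] by (simp add: a_def)
  qed
  have ac: "absolutely_continuous circle_lebesgue \<nu>"
    unfolding absolutely_continuous_def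
  proof
    fix A assume A: "A \<in> null_sets circle_lebesgue"
    then have A_borel: "A \<in> sets borel"
      by auto
    have "emeasure circle_lebesgue ((f ^^ i) -` A) = 0" for i
      using null_sets_vimage_pl[OF pl_lift_funpow[OF f] A] by blast
    then have "emeasure \<nu> A = 0"
      by (simp add: \<nu>[OF A_borel])
    then show "A \<in> null_sets \<nu>"
      using A_borel by (simp add: null_sets_def sets)
  qed
  have "emeasure \<nu> U > 0" if "open U" "x \<in> U" for U x
  proof -
    have "0 < emeasure circle_lebesgue ((f ^^ 0) -` U)"
      using emeasure_circle_lebesgue_open_pos[of U] that by auto
    also have "\<dots> \<le> (\<Sum>i<Q. emeasure circle_lebesgue ((f ^^ i) -` U))"
      by (rule member_le_sum) (use \<open>Q > 0\<close> in auto)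
    finally show ?thesis
      using that(1) \<open>Q > 0\<close> by (simp add: \<nu> ennreal_zero_less_divide)
  qed
  then have "measure_support \<nu> = UNIV"
    by (auto simp: measure_support_def)
  with prob inv ac show thesis
    by (rule that)
qed

section \<open>The equivalence\<close>

text \<open>Passes from indices of break points to the break points themselves, which does not change
products because different indices belong to different points of the circle.\<close>

lemma break_orbit_conditions_indexed:
  assumes breaks: "break_points f = (\<lambda>i. to_circle (b i)) ` {1..n}"
    and inj: "inj_on (\<lambda>i. to_circle (b i)) {1..n}"
  shows "(\<forall>i\<in>{1..n}.
        (\<exists>j\<in>{1..n}. j \<noteq> i \<and> to_circle (b j) \<in> full_orbit f (to_circle (b i))) \<and>
        trivial_cancellations f n b {j\<in>{1..n}. to_circle (b j) \<in> full_orbit f (to_circle (b i))})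
    \<longleftrightarrow> (\<forall>y\<in>break_points f. (\<exists>z\<in>break_points f. z \<noteq> y \<and> z \<in> full_orbit f y) \<and>
        (\<Prod>z\<in>break_points f \<inter> full_orbit f y. jump f z) = 1)"
proof -
  define t where "t i = to_circle (b i)" for i
  have breaks: "break_points f = t ` {1..n}" and inj: "inj_on t {1..n}"
    using assms by (simp_all add: t_def[abs_def])
  have "((\<exists>j\<in>{1..n}. j \<noteq> i \<and> t j \<in> full_orbit f (t i)) \<and>
        trivial_cancellations f n b {j\<in>{1..n}. t j \<in> full_orbit f (t i)})
    \<longleftrightarrow> ((\<exists>z\<in>break_points f. z \<noteq> t i \<and> z \<in> full_orbit f (t i)) \<and>
        (\<Prod>z\<in>break_points f \<inter> full_orbit f (t i). jump f z) = 1)"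
    if i: "i \<in> {1..n}" for i
  proof -
    define S where "S = {j\<in>{1..n}. t j \<in> full_orbit f (t i)}"
    have S: "S \<subseteq> {1..n}" "finite S"
      by (auto simp: S_def)
    have "i \<in> S"
      using i by (auto simp: S_def full_orbit_def image_iff intro!: exI[of _ 0])
    have other: "(\<exists>j\<in>{1..n}. j \<noteq> i \<and> t j \<in> full_orbit f (t i))
        \<longleftrightarrow> (\<exists>z\<in>break_points f. z \<noteq> t i \<and> z \<in> full_orbit f (t i))"
      using i inj by (auto simp: breaks dest: inj_onD)
    have "1 < card S" if ex: "\<exists>j\<in>{1..n}. j \<noteq> i \<and> t j \<in> full_orbit f (t i)"
    proof -
      obtain j where j: "j \<in> S" "j \<noteq> i"
        using ex by (auto simp: S_def)
      have "card {i, j} \<le> card S"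
        using \<open>i \<in> S\<close> j(1) S(2) by (intro card_mono) auto
      with j(2) show ?thesis
        by simp
    qed
    moreover have "trivial_cancellations f n b S \<longleftrightarrow> 1 < card S \<and> (\<Prod>j\<in>S. jump f (t j)) = 1"
      using S(1) card_mono[OF _ S(1)] by (simp add: trivial_cancellations_def t_def)
    moreover have "(\<Prod>z\<in>break_points f \<inter> full_orbit f (t i). jump f z) = (\<Prod>j\<in>S. jump f (t j))"
    proof -
      have "t ` S = break_points f \<inter> full_orbit f (t i)"
        by (auto simp: breaks S_def)
      then show ?thesis
        using prod.reindex[OF inj_on_subset[OF inj S(1)], of "jump f"] by (simp add: comp_def)
    qed
    ultimately show ?thesis
      unfolding S_def[symmetric] other[symmetric] by auto
  qed
  then show ?thesis
    unfolding t_def[symmetric] by (simp add: breaks)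
qed

theorem theorem2p4:
  fixes f :: "circle \<Rightarrow> circle" and n :: nat and b :: "nat \<Rightarrow> real" and p q :: int
  assumes "pwl_with_breaks f n b" and "n \<ge> 2"
    and "q > 0" and "rotation_number f = to_circle (real_of_int p / real_of_int q)"
  shows "all_equivalent
    [(\<forall>i\<in>{1..n}.
        (\<exists>j\<in>{1..n}. j \<noteq> i \<and> to_circle (b j) \<in> full_orbit f (to_circle (b i))) \<and>
        trivial_cancellations f n b {j\<in>{1..n}. to_circle (b j) \<in> full_orbit f (to_circle (b i))}),
     (\<exists>\<nu>. prob_space \<nu> \<and> invariant_measure f \<nu> \<and>
        absolutely_continuous circle_lebesgue \<nu> \<and> measure_support \<nu> = UNIV),
     (\<exists>h \<omega>. pwl h \<and> h \<circ> f = rotation \<omega> \<circ> h),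
     (\<exists>N\<^sub>1::nat. \<forall>k\<ge>1. finite (break_points (f ^^ k)) \<and> card (break_points (f ^^ k)) \<le> N\<^sub>1),
     (\<exists>N\<^sub>2::real. \<forall>k\<ge>1. \<forall>x. deriv_right (f ^^ k) x \<le> N\<^sub>2 \<and> deriv_left (f ^^ k) x \<le> N\<^sub>2)]"
    (is "all_equivalent [?cancel, ?measure, ?conj, ?breaks, ?derivs]")
proof -
  define Q where "Q = nat q"
  have "Q > 0" and Q: "real_of_int q = real Q"
    using assms(3) by (simp_all add: Q_def)
  have "n \<ge> 1"
    using assms(2) by simp
  from pwl_with_breaksD[OF assms(1) this] obtain F0 M where F0: "pl_lift f F0"
    and breaks: "break_points f = (\<lambda>i. to_circle (b i)) ` {1..n}"
    and inj: "inj_on (\<lambda>i. to_circle (b i)) {1..n}"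
    and M: "\<And>x. deriv_right f x \<le> M" "\<And>x. deriv_left f x \<le> M"
    by blast
  have fin: "finite (break_points f)"
    by (simp add: breaks)
  obtain F c where F: "is_lift f F" and c: "(F ^^ Q) c = c + of_int p"
    using periodic_point_of_rational_rotation_number[OF pl_lift_is_lift[OF F0] \<open>Q > 0\<close>] assms(4)
    unfolding Q by blast
  have f: "pl_lift f F"
    by (rule pl_lift_change[OF F0 F])
  define G where "G x = (F ^^ Q) x + of_int (- p)" for x
  have G: "is_lift (f ^^ Q) G"
    unfolding G_def by (rule is_lift_shift[OF is_lift_funpow[OF F]])
  have Gc: "G c = c"
    by (simp add: G_def c)
  have fixed: "(f ^^ Q) (to_circle c) = to_circle c"
    using is_liftD(4)[OF G, of c] Gc by simp
  have cancel: "?cancel \<longleftrightarrow> (\<forall>y\<in>break_points f. (\<exists>z\<in>break_points f. z \<noteq> y \<and> z \<in> full_orbit f y) \<and>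
      (\<Prod>z\<in>break_points f \<inter> full_orbit f y. jump f z) = 1)"
    by (rule break_orbit_conditions_indexed[OF breaks inj])
  have "?cancel \<longleftrightarrow> f ^^ Q = id"
  proof
    assume c: ?cancel
    show "f ^^ Q = id"
    proof (rule ccontr)
      assume "f ^^ Q \<noteq> id"
      from aperiodic_nontrivial_orbit[OF f fin G Gc this] obtain y
        where "y \<in> break_points f" "(\<Prod>z\<in>break_points f \<inter> full_orbit f y. jump f z) \<noteq> 1"
        by metis
      with c show False
        unfolding cancel by blast
    qed
  next
    assume per: "f ^^ Q = id"
    show ?cancel
      unfolding cancel using break_orbit_conditions_if_periodic[OF f per \<open>Q > 0\<close>]
        orbit_product_trivial_if_periodic[OF f per \<open>Q > 0\<close>] by blast
  qed
  moreover have "?measure \<longleftrightarrow> f ^^ Q = id"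
    using periodic_if_invariant_measure[OF F G Gc] invariant_measure_if_periodic[OF f _ \<open>Q > 0\<close>] by metis
  moreover have "?conj \<longleftrightarrow> f ^^ Q = id"
  proof
    assume ?conj
    then obtain h \<omega> where h: "pwl h" "h \<circ> f = rotation \<omega> \<circ> h"
      by blast
    then have "inj h"
      unfolding pwl_def pwl_with_breaks_def orientation_preserving_homeo_def
      using bij_of_lift bij_is_inj by blast
    from periodic_if_conjugate_to_rotation[OF this h(2) fixed] show "f ^^ Q = id" .
  next
    assume per: "f ^^ Q = id"
    \<comment> \<open>\<open>G\<close> lifts the identity and has a fixed point, so it is the identity.\<close>
    have "is_lift id G"
      using G by (simp add: per)
    then obtain k where k: "\<And>x. G x = x + of_int k"
      using lift_unique[OF is_lift_id] by blast
    then have "k = 0"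
      using Gc k[of c] by simp
    then have "(F ^^ Q) x = x + of_int p" for x
      using k[of x] by (simp add: G_def)
    from conjugate_to_rotation_if_periodic[OF f fin \<open>Q > 0\<close> this] show ?conj
      by metis
  qed
  moreover have "?breaks \<longleftrightarrow> f ^^ Q = id"
    using periodic_if_break_points_bounded[OF f fin G Gc] finite_break_points_funpow[OF f fin]
      break_points_bounded_if_periodic[OF f fin _ \<open>Q > 0\<close>] by metis
  moreover have "?derivs \<longleftrightarrow> f ^^ Q = id"
    using periodic_if_derivatives_bounded[OF f G Gc \<open>Q > 0\<close>]
      derivatives_bounded_if_periodic[OF f _ \<open>Q > 0\<close> M] by metis
  ultimately show ?thesis
    unfolding all_equivalent_def by simp
qed

end
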